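(* Let $F=\{\sigma_1,\dots,\sigma_n\}\subset\partial\mathbb{D}$ consist of pairwise distinct points and let $\Lambda=(\lambda_1,\dots,\lambda_n)\in(-\infty,0)^n$. Put $r:=\big(\sum_{k=1}^n|\lambda_k|^{-1}\big)^{-1}$ and $\Omega:=\{\omega:|\omega-r|\le r\}$. For $\omega\in\Omega\setminus\{0\}$ put $$Z_\omega:=\Big\{\zeta\in\mathbb{C}:\Big|\frac{\zeta}{2\omega^2}-\sum_{k=1}^n\frac{\overline\sigma_k}{|\lambda_k|}\Big|\le2\,\mathrm{Re}\frac1\omega-\sum_{k=1}^n|\lambda_k|^{-1}\Big\},$$ and $Z_0:=\{0\}$. Then $$\widehat V(F,\Lambda):=\{(G''(0),\lambda(G)):G\in\mathsf{Gen}_0(F,\Lambda)\}=\{(\zeta,\omega)\in\mathbb{C}^2:\omega\in\Omega,\ \zeta\in Z_\omega\}.$$ Moreover, each boundary point of $\widehat V(F,\Lambda)$ is delivered by a unique $G\in\mathsf{Gen}_0(F,\Lambda)$. Writing $\hat\ell_\omega:=1/\omega-\frac12\sum_{k=1}^n|\lambda_k|^{-1}$, this $G$ has one of the following forms: - $G(z)=-\dfrac{z}{\frac{\sigma+z}{\sigma-z}\mathrm{Re}\,\hat\ell_\omega+i\,\mathrm{Im}\,\hat\ell_\omega+p_0(z;F,\Lambda)}$ with $\omega$ in the interior of $\Omega$ and $\sigma\in\partial\mathbb{D}$; - $G(z)=-\dfrac{z}{i\,\mathrm{Im}\,\hat\ell_\omega+p_0(z;F,\Lambda)}$ with $\omega\in\partial\Omega\setminus\{0\}$;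 - $G\equiv0$.
   Context: $\mathbb{D}$ is the open unit disk. A one-parameter semigroup $(\phi_t)_{t\ge0}$ of holomorphic self-maps of $\mathbb{D}$ satisfies $\phi_0=\mathrm{id}$, $\phi_s\circ\phi_t=\phi_{s+t}$, and $\phi_t\to\mathrm{id}$ pointwise as $t\to 0^+$. Its infinitesimal generator $G$ satisfies $\frac{d}{dt}\phi_t(z)=G(\phi_t(z))$. $\mathsf{Gen}_0$ is the set of generators of semigroups with Denjoy–Wolff point $0$, together with $G\equiv0$. For such $G$, $\lambda(G)=-G'(0)$ is the spectral value at the Denjoy–Wolff point. A point $\sigma\in\partial\mathbb{D}$ is a boundary regular fixed point (BRFP) if each $\phi_t$ has angular limit $\sigma$ and a finite angular derivative at $\sigma$. The spectral value $\lambda'$ there is given by $\phi_t'(\sigma)=e^{-\lambda' t}$, equivalently $\lambda'=\angle\lim_{z\to\sigma}G(z)/(\sigma-z)$. $\mathsf{Gen}_0(F,\Lambda)$ is the set of $G\in\mathsf{Gen}_0$ whose semigroup has BRFPs at all $\sigma_k$ with spectral values $\lambda'_k\in[\lambda_k,0]$ (including $G\equiv0$). With $\tau=0$, $p_0(z;F,\Lambda):=\sum_{k=1}^n\frac{|\tau-\sigma_k|^2}{2|\lambda_k|}\frac{\sigma_k+z}{\sigma_k-z}=\sum_{k=1}^n\frac{1}{2|\lambda_k|}\frac{\sigma_k+z}{\sigma_k-z}$. *)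

theory Defs
  imports "HOL-Analysis.Analysis"
begin

definition unit_disk :: "complex set" where
  "unit_disk = ball 0 1"

definition is_semigroup :: "(real \<Rightarrow> complex \<Rightarrow> complex) \<Rightarrow> bool" where
  "is_semigroup \<phi> \<longleftrightarrow>
     (\<forall>t\<ge>0. \<phi> t holomorphic_on unit_disk \<and> \<phi> t ` unit_disk \<subseteq> unit_disk) \<and>
     (\<forall>z\<in>unit_disk. \<phi> 0 z = z) \<and>
     (\<forall>s\<ge>0. \<forall>t\<ge>0. \<forall>z\<in>unit_disk. \<phi> (s + t) z = \<phi> s (\<phi> t z)) \<and>
     (\<forall>z\<in>unit_disk. ((\<lambda>t. \<phi> t z) \<longlongrightarrow> z) (at_right 0))"

definition generates :: "(complex \<Rightarrow> complex) \<Rightarrow> (real \<Rightarrow> complex \<Rightarrow> complex) \<Rightarrow> bool" where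
  "generates G \<phi> \<longleftrightarrow> is_semigroup \<phi> \<and> G holomorphic_on unit_disk \<and>
     (\<forall>z\<in>unit_disk. \<forall>t\<ge>0.
        ((\<lambda>s. \<phi> s z) has_vector_derivative G (\<phi> t z)) (at t within {0..}))"

definition stolz :: "complex \<Rightarrow> real \<Rightarrow> complex set" where
  "stolz \<sigma> M = {z. norm z < 1 \<and> cmod (\<sigma> - z) < M * (1 - cmod z)}"

definition angular_limit :: "(complex \<Rightarrow> complex) \<Rightarrow> complex \<Rightarrow> complex \<Rightarrow> bool" where
  "angular_limit f \<sigma> L \<longleftrightarrow> (\<forall>M>1. (f \<longlongrightarrow> L) (at \<sigma> within stolz \<sigma> M))"

text \<open>\<sigma> is a boundary regular fixed point of the semigroup with spectral value \<mu>:
  each \<phi>_t has angular limit \<sigma> at \<sigma> and angular derivative \<phi>_t'(\<sigma>) = exp(-\<mu> t).\<close>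
definition is_BRFP :: "(real \<Rightarrow> complex \<Rightarrow> complex) \<Rightarrow> complex \<Rightarrow> real \<Rightarrow> bool" where
  "is_BRFP \<phi> \<sigma> \<mu> \<longleftrightarrow> cmod \<sigma> = 1 \<and>
     (\<forall>t\<ge>0. angular_limit (\<phi> t) \<sigma> \<sigma> \<and>
        angular_limit (\<lambda>z. (\<phi> t z - \<sigma>) / (z - \<sigma>)) \<sigma> (complex_of_real (exp (- \<mu> * t))))"

text \<open>Gen_0: generators of semigroups with Denjoy--Wolff point 0 (i.e. fixing 0),
  which includes G = 0.\<close>
definition Gen0 :: "(complex \<Rightarrow> complex) set" where
  "Gen0 = {G. \<exists>\<phi>. generates G \<phi> \<and> (\<forall>t\<ge>0. \<phi> t 0 = 0)}"

definition Gen0_FL :: "nat \<Rightarrow> (nat \<Rightarrow> complex) \<Rightarrow> (nat \<Rightarrow> real) \<Rightarrow> (complex \<Rightarrow> complex) set" where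
  "Gen0_FL n \<sigma> lam = {G. \<exists>\<phi>. generates G \<phi> \<and> (\<forall>t\<ge>0. \<phi> t 0 = 0) \<and>
      (\<forall>k\<in>{1..n}. \<exists>\<mu>. is_BRFP \<phi> (\<sigma> k) \<mu> \<and> lam k \<le> \<mu> \<and> \<mu> \<le> 0)}"

definition p0 :: "nat \<Rightarrow> (nat \<Rightarrow> complex) \<Rightarrow> (nat \<Rightarrow> real) \<Rightarrow> complex \<Rightarrow> complex" where
  "p0 n \<sigma> lam z = (\<Sum>k\<in>{1..n}. complex_of_real (1 / (2 * \<bar>lam k\<bar>)) * ((\<sigma> k + z) / (\<sigma> k - z)))"

definition rad :: "nat \<Rightarrow> (nat \<Rightarrow> real) \<Rightarrow> real" where
  "rad n lam = 1 / (\<Sum>k\<in>{1..n}. 1 / \<bar>lam k\<bar>)"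

definition Omega :: "nat \<Rightarrow> (nat \<Rightarrow> real) \<Rightarrow> complex set" where
  "Omega n lam = {\<omega>. cmod (\<omega> - complex_of_real (rad n lam)) \<le> rad n lam}"

definition Zset :: "nat \<Rightarrow> (nat \<Rightarrow> complex) \<Rightarrow> (nat \<Rightarrow> real) \<Rightarrow> complex \<Rightarrow> complex set" where
  "Zset n \<sigma> lam \<omega> = (if \<omega> = 0 then {0} else
     {\<zeta>. cmod (\<zeta> / (2 * \<omega>\<^sup>2) - (\<Sum>k\<in>{1..n}. cnj (\<sigma> k) / complex_of_real \<bar>lam k\<bar>))
          \<le> 2 * Re (1 / \<omega>) - (\<Sum>k\<in>{1..n}. 1 / \<bar>lam k\<bar>)})"

definition ellhat :: "nat \<Rightarrow> (nat \<Rightarrow> real) \<Rightarrow> complex \<Rightarrow> complex" where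
  "ellhat n lam \<omega> = 1 / \<omega> - complex_of_real ((1/2) * (\<Sum>k\<in>{1..n}. 1 / \<bar>lam k\<bar>))"

definition Vpt :: "(complex \<Rightarrow> complex) \<Rightarrow> complex \<times> complex" where
  "Vpt G = (deriv (deriv G) 0, - deriv G 0)"

end

theory Submission
  imports Defs "HOL-Complex_Analysis.Complex_Analysis"
begin

text \<open>A generator fixing the origin is \<open>G = - z p\<close> with \<open>Re p \<ge> 0\<close>. If \<open>G\<close> is not zero, \<open>q = 1 / p\<close> has
  positive real part, and a boundary regular fixed point at \<open>\<sigma>\<close> with spectral value \<open>\<mu>\<close> amounts
  to an atom of mass \<open>1 / (2 \<bar>\<mu>\<bar>)\<close> at \<open>\<sigma>\<close> in the Herglotz representation of \<open>q\<close>. So membership in the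
  class means that \<open>q - p\<^sub>0\<close> has nonnegative real part. The value set is then the region of possible
  \<open>(f 0, f' 0)\<close> for functions \<open>f\<close> with nonnegative real part, given by \<open>\<bar>f' 0\<bar> \<le> 2 Re (f 0)\<close>, and the
  extremal \<open>f\<close> are the Cayley kernels, by the Schwarz lemma.

  Atoms are handled without measures, as radial limits of \<open>q (r \<sigma>) (1 - r)\<close> (Julia-Wolff).\<close>

section \<open>Functions with nonnegative real part\<close>

text \<open>The constant \<open>1 / (2 |\<mu>|)\<close> comes from the pole: if \<open>q\<close>
  behaves like \<open>c (\<sigma> + z) / (\<sigma> - z)\<close> near \<open>\<sigma>\<close>, then
  \<open>G = - z / q\<close> behaves like \<open>(z - \<sigma>) / (2 c)\<close>. A smaller
  \<open>|\<mu>|\<close> is thus a larger mass, and \<open>lam k \<le> \<mu>\<close> says that at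
  least the mass occurring in \<open>p0\<close> is present. The two inclusions need different tools.
  Necessity concerns an arbitrary semigroup of the class, for which Julia's inequality,
  differentiated at time 0, carries the information. Sufficiency has to build a semigroup from
  \<open>q\<close> and control it at the boundary. For this it is enough to realise
  \<open>q = p0 + a cayley 1 (\<eta> z) + i b\<close> with \<open>a \<ge> 0\<close> and
  \<open>|\<eta>| \<le> 1\<close>, since these already reach every admissible value and derivative
  at 0. At each node such a \<open>q\<close> is a multiple of the kernel plus a function continuous
  there, so unrestricted limits inside the disk and a Gronwall estimate for the flow give the
  angular limits.\<close>

definition cayley :: "complex \<Rightarrow> complex \<Rightarrow> complex" where
  "cayley \<sigma> z = (\<sigma> + z) / (\<sigma> - z)"

text \<open>The right side is the Poisson kernel of the disk with pole
  \<open>\<sigma>\<close>.\<close>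

lemma Re_cayley:
  assumes "cmod \<sigma> = 1"
  shows "Re (cayley \<sigma> z) = (1 - (cmod z)\<^sup>2) / (cmod (\<sigma> - z))\<^sup>2"
proof -
  have "Re ((\<sigma> + z) * cnj (\<sigma> - z)) = (cmod \<sigma>)\<^sup>2 - (cmod z)\<^sup>2"
    unfolding cmod_power2 by (simp add: algebra_simps power2_eq_square)
  moreover have "cayley \<sigma> z = ((\<sigma> + z) * cnj (\<sigma> - z)) / of_real ((cmod (\<sigma> - z))\<^sup>2)"
    unfolding cayley_def by (subst complex_div_cnj) simp
  ultimately show ?thesis
    using assms by (simp only: Re_divide_of_real) simp
qed

lemma Re_cayley_pos:
  assumes "cmod \<sigma> = 1" "z \<in> ball 0 1"
  shows "Re (cayley \<sigma> z) > 0"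
proof -
  have "\<sigma> \<noteq> z" using assms by auto
  moreover have "(cmod z)\<^sup>2 < 1"
    using assms by (simp add: power_less_one_iff abs_square_less_1)
  ultimately show ?thesis using assms by (simp add: Re_cayley)
qed

lemma cayley_holomorphic [holomorphic_intros]:
  assumes "\<sigma> \<notin> S"
  shows "cayley \<sigma> holomorphic_on S"
  unfolding cayley_def using assms by (intro holomorphic_intros) auto

text \<open>If the real part vanishes somewhere and \<open>q\<close> is not constant, the open
  mapping theorem yields values left of the imaginary axis. This isolates the imaginary constants,
  for which the Cayley quotients below would divide by zero.\<close>

lemma nonneg_Re_dichotomy:
  assumes hol: "q holomorphic_on ball 0 1" and nn: "\<And>z. z \<in> ball 0 1 \<Longrightarrow> 0 \<le> Re (q z)"
  shows "(\<forall>z\<in>ball 0 1. 0 < Re (q z)) \<or> (\<exists>b. \<forall>z\<in>ball 0 1. q z = \<i> * complex_of_real b)"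
proof (rule ccontr)
  assume neg: "\<not> ?thesis"
  then obtain z0 where z0: "z0 \<in> ball 0 1" "Re (q z0) = 0"
    using nn by (metis order_le_less)
  show False
  proof (cases "q constant_on ball 0 1")
    case True
    then have "q z = \<i> * complex_of_real (Im (q z0))" if "z \<in> ball 0 1" for z
      using z0 that by (auto simp: constant_on_def complex_eq_iff)
    then show False using neg by blast
  next
    case False
    have "open (q ` ball 0 1)"
      by (rule open_mapping_thm [OF hol _ _ _ _ False]) auto
    then obtain e where e: "e > 0" "ball (q z0) e \<subseteq> q ` ball 0 1"
      using z0 by (meson imageI openE)
    have "q z0 - of_real (e / 2) \<in> ball (q z0) e"
      using e by (simp add: dist_norm)
    then obtain z where z: "z \<in> ball 0 1" "q z = q z0 - of_real (e/2)"
      using e by (metis (no_types, lifting) imageE subsetD)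
    then have "Re (q z) < 0" using z0 e by simp
    then show False using nn z by fastforce
  qed
qed

section \<open>Pick's inequality for the right half-plane\<close>

lemma cmod_diff_squares:
  "(cmod (a + cnj b))\<^sup>2 - (cmod (a - b))\<^sup>2 = 4 * Re a * Re b"
  unfolding cmod_power2 by (simp add: algebra_simps power2_eq_square)

lemma cmod_moebius_identity:
  "(cmod (1 - cnj w * z))\<^sup>2 - (cmod (z - w))\<^sup>2 = (1 - (cmod z)\<^sup>2) * (1 - (cmod w)\<^sup>2)"
  unfolding cmod_power2 by (simp add: algebra_simps power2_eq_square)

lemma cmod_less_1_iff: "cmod z < 1 \<longleftrightarrow> 0 < 1 - (cmod z)\<^sup>2"
  by (simp add: abs_square_less_1)

text \<open>For fixed \<open>b\<close> this quotient is the Cayley map of the right half-plane onto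
  the disk that sends \<open>b\<close> to 0.\<close>

lemma cayley_quotient_bound:
  assumes "0 < Re a" "0 < Re b"
  shows "cmod ((a - b) / (a + cnj b)) < 1" "a + cnj b \<noteq> 0"
proof -
  show ne: "a + cnj b \<noteq> 0" using assms by (auto simp: complex_eq_iff)
  have "(cmod (a - b))\<^sup>2 < (cmod (a + cnj b))\<^sup>2"
    using cmod_diff_squares [of a b] mult_pos_pos [OF assms] by linarith
  then have "cmod (a - b) < cmod (a + cnj b)"
    by (rule power2_less_imp_less) simp
  then show "cmod ((a - b) / (a + cnj b)) < 1"
    using ne by (simp add: norm_divide)
qed

text \<open>Schwarz's lemma after moving \<open>w\<close> and \<open>q w\<close> to 0; equivalently,
  the 2 by 2 Pick determinant is nonnegative. The form without quotients also covers imaginary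
  constants and lets a point approach the boundary in \<open>julia_wolff\<close>.\<close>

lemma pick_inequality:
  assumes hol: "q holomorphic_on ball 0 1" and nn: "\<And>z. z \<in> ball 0 1 \<Longrightarrow> 0 \<le> Re (q z)"
    and z: "z \<in> ball 0 1" and w: "w \<in> ball 0 1"
  shows "(cmod (q z + cnj (q w)))\<^sup>2 * ((1 - (cmod z)\<^sup>2) * (1 - (cmod w)\<^sup>2))
    \<le> 4 * Re (q z) * Re (q w) * (cmod (1 - cnj w * z))\<^sup>2"
proof -
  have "(\<forall>z\<in>ball 0 1. 0 < Re (q z)) \<or> (\<exists>b. \<forall>z\<in>ball 0 1. q z = \<i> * complex_of_real b)"
    using nonneg_Re_dichotomy hol nn by blast
  then show ?thesis
  proof (elim disjE exE)
    fix b assume "\<forall>z\<in>ball 0 1. q z = \<i> * complex_of_real b"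
    then show ?thesis using z w by simp
  next
    assume pos: "\<forall>z\<in>ball 0 1. 0 < Re (q z)"
    have lt1: "cmod (cnj w * \<xi>) < 1" if "cmod \<xi> < 1" for \<xi>
      using that w mult_strict_mono' [of "cmod w" 1 "cmod \<xi>" 1] by (simp add: norm_mult)
    have ne: "1 + cnj w * \<xi> \<noteq> 0" "1 - cnj w * \<xi> \<noteq> 0" if "cmod \<xi> < 1" for \<xi>
      using lt1 [OF that] by (auto simp: add_eq_0_iff)
    \<comment> \<open>\<open>M\<close> is the disk automorphism taking 0 to \<open>w\<close>;
      \<open>F\<close> below is the Cayley transform of \<open>q\<close> composed with
      \<open>M\<close>, centred so that it vanishes at 0.\<close>
    define M where "M = (\<lambda>\<xi>. (\<xi> + w) / (1 + cnj w * \<xi>))"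
    have M: "M \<xi> \<in> ball 0 1" if "cmod \<xi> < 1" for \<xi>
    proof -
      have "0 < (1 - (cmod \<xi>)\<^sup>2) * (1 - (cmod w)\<^sup>2)"
        using that w by (simp add: cmod_less_1_iff)
      then have "(cmod (\<xi> + w))\<^sup>2 < (cmod (1 + cnj w * \<xi>))\<^sup>2"
        using cmod_moebius_identity [of "-w" \<xi>] by simp
      then have "cmod (\<xi> + w) < cmod (1 + cnj w * \<xi>)"
        by (rule power2_less_imp_less) simp
      then show ?thesis using ne [OF that] by (simp add: M_def norm_divide)
    qed
    define F where "F = (\<lambda>\<xi>. (q (M \<xi>) - q w) / (q (M \<xi>) + cnj (q w)))"
    have qM: "0 < Re (q (M \<xi>))" "0 < Re (q w)" if "cmod \<xi> < 1" for \<xi>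
      using pos M that w by auto
    have "M holomorphic_on ball 0 1"
      unfolding M_def using ne by (intro holomorphic_intros) auto
    then have "(q \<circ> M) holomorphic_on ball 0 1"
      using hol M by (intro holomorphic_on_compose_gen) auto
    then have "F holomorphic_on ball 0 1"
      unfolding F_def comp_def using cayley_quotient_bound(2) [OF qM]
      by (intro holomorphic_intros) auto
    moreover have "F 0 = 0" by (simp add: F_def M_def)
    moreover have "cmod (F \<xi>) < 1" if "cmod \<xi> < 1" for \<xi>
      unfolding F_def by (rule cayley_quotient_bound(1) [OF qM [OF that]])
    ultimately have F: "cmod (F \<xi>) \<le> cmod \<xi>" if "cmod \<xi> < 1" for \<xi>
      using Schwarz_Lemma(1) that by blast
    define \<xi> where "\<xi> = (z - w) / (1 - cnj w * z)"
    have z1: "cmod z < 1" using z by simp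
    have "0 < (1 - (cmod z)\<^sup>2) * (1 - (cmod w)\<^sup>2)"
      using z w by (simp add: cmod_less_1_iff)
    then have "(cmod (z - w))\<^sup>2 < (cmod (1 - cnj w * z))\<^sup>2"
      using cmod_moebius_identity [of w z] by simp
    then have "cmod (z - w) < cmod (1 - cnj w * z)"
      by (rule power2_less_imp_less) simp
    then have \<xi>1: "cmod \<xi> < 1" using ne [OF z1] by (simp add: \<xi>_def norm_divide)
    have "1 - cnj w * w \<noteq> 0" using ne w by simp
    then have Mz: "M \<xi> = z"
      using ne(2) [OF z1] ne(1) [OF \<xi>1] unfolding M_def \<xi>_def
      by (simp add: divide_simps) (simp add: algebra_simps)
    have ne2: "q z + cnj (q w) \<noteq> 0"
      using cayley_quotient_bound(2) pos z w by blast
    have "cmod (q z - q w) * cmod (1 - cnj w * z) \<le> cmod (z - w) * cmod (q z + cnj (q w))"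
      using F [OF \<xi>1] ne(2) [OF z1] ne2 unfolding F_def Mz
      by (simp add: \<xi>_def norm_divide divide_simps mult.commute)
    then have "(cmod (q z - q w) * cmod (1 - cnj w * z))\<^sup>2
        \<le> (cmod (z - w) * cmod (q z + cnj (q w)))\<^sup>2"
      by (intro power_mono) auto
    then have "(cmod (q z - q w))\<^sup>2 * (cmod (1 - cnj w * z))\<^sup>2
        \<le> (cmod (z - w))\<^sup>2 * (cmod (q z + cnj (q w)))\<^sup>2"
      by (simp add: power_mult_distrib)
    \<comment> \<open>Both squared differences are traded for larger squares by the two identities;
      the product of these squares cancels and Pick's form remains.\<close>
    moreover have "(cmod (q z - q w))\<^sup>2 = (cmod (q z + cnj (q w)))\<^sup>2 - 4 * Re (q z) * Re (q w)"
      using cmod_diff_squares [of "q z" "q w"] by simp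
    moreover have "(cmod (z - w))\<^sup>2 = (cmod (1 - cnj w * z))\<^sup>2 - (1 - (cmod z)\<^sup>2) * (1 - (cmod w)\<^sup>2)"
      using cmod_moebius_identity [of w z] by simp
    ultimately show ?thesis by (simp add: algebra_simps)
  qed
qed

text \<open>At \<open>s = \<sigma>\<close> the factor \<open>1 - r\<close> cancels the pole and
  leaves \<open>1 + r\<close>; otherwise the kernel is finite at \<open>\<sigma>\<close>. The value
  2 is why a mass \<open>c\<close> shows up as the radial limit \<open>2 * c\<close>.\<close>

lemma tendsto_cayley_radial:
  assumes "cmod s = 1" "cmod \<sigma> = 1"
  shows "((\<lambda>r. cayley s (complex_of_real r * \<sigma>) * complex_of_real (1 - r)) \<longlongrightarrow>
           (if s = \<sigma> then 2 else 0)) (at_left 1)"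
proof (cases "s = \<sigma>")
  case True
  have "s \<noteq> 0" using assms by auto
  have "((\<lambda>r. 1 + complex_of_real r) \<longlongrightarrow> 1 + of_real 1) (at_left 1)"
    by (intro tendsto_intros)
  moreover have "\<forall>\<^sub>F r in at_left 1. 1 + complex_of_real r
      = cayley s (complex_of_real r * \<sigma>) * complex_of_real (1 - r)"
    unfolding eventually_at_left_field
  proof (intro exI [of _ 0] conjI allI impI)
    fix r :: real assume r: "0 < r" "r < 1"
    have "s + complex_of_real r * s = s * (1 + of_real r)"
      "s - complex_of_real r * s = s * of_real (1 - r)"
      by (auto simp: algebra_simps)
    then show "1 + complex_of_real r = cayley s (complex_of_real r * \<sigma>) * complex_of_real (1 - r)"
      using r \<open>s \<noteq> 0\<close> True by (simp add: cayley_def)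
  qed auto
  ultimately show ?thesis using True by (simp add: Lim_transform_eventually)
next
  case False
  have "((\<lambda>r. cayley s (complex_of_real r * \<sigma>) * complex_of_real (1 - r)) \<longlongrightarrow>
      (s + of_real 1 * \<sigma>) / (s - of_real 1 * \<sigma>) * of_real (1 - 1)) (at_left 1)"
    unfolding cayley_def using False by (intro tendsto_intros) auto
  then show ?thesis using False by simp
qed

text \<open>Expand the square, drop \<open>a^2\<close> and divide by \<open>x\<close>. In
  \<open>julia_wolff\<close>, \<open>a\<close> tends to 0, so that \<open>T\<close> decides.\<close>

lemma quadratic_bound:
  fixes x a T :: real
  assumes "(x - a)\<^sup>2 \<le> T * x" "0 \<le> a" "0 \<le> T" "0 \<le> x"
  shows "x \<le> T + 2 * a"
proof (rule ccontr)
  assume "\<not> ?thesis"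
  then have "x > T + 2 * a" by simp
  then have "(x - 2 * a - T) * x > 0" using assms by (intro mult_pos_pos) auto
  then have "(x - a)\<^sup>2 > T * x + a\<^sup>2" by (simp add: power2_eq_square algebra_simps)
  then show False using assms(1) by (smt (verit) zero_le_power2)
qed

text \<open>The mass \<open>c\<close> is the infimum of \<open>Re q\<close> over the Poisson kernel,
  the largest multiple of the kernel that \<open>q\<close> dominates. The remainder \<open>k\<close>
  has infimum 0, and Pick's inequality between a point where its quotient is small and a point of
  the radius forces its radial limit to vanish. As this bounds the modulus of \<open>k\<close>, the
  full complex limit follows.\<close>

theorem julia_wolff:
  assumes hol: "q holomorphic_on ball 0 1" and nn: "\<And>z. z \<in> ball 0 1 \<Longrightarrow> 0 \<le> Re (q z)"
    and \<sigma>: "cmod \<sigma> = 1"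
  obtains c where "0 \<le> c"
    "((\<lambda>r. q (complex_of_real r * \<sigma>) * complex_of_real (1 - r)) \<longlongrightarrow> complex_of_real (2 * c)) (at_left 1)"
    "\<And>z. z \<in> ball 0 1 \<Longrightarrow> c * Re (cayley \<sigma> z) \<le> Re (q z)"
proof -
  define \<rho> where "\<rho> = (\<lambda>z. Re (q z) / Re (cayley \<sigma> z))"
  define c where "c = (INF z\<in>ball 0 1. \<rho> z)"
  have hpos: "0 < Re (cayley \<sigma> z)" if "z \<in> ball 0 1" for z
    using Re_cayley_pos \<sigma> that by blast
  have \<rho>nn: "0 \<le> \<rho> z" if "z \<in> ball 0 1" for z
    unfolding \<rho>_def using nn hpos that by (simp add: less_imp_le)
  have bdd: "bdd_below (\<rho> ` ball 0 1)" using \<rho>nn by (auto intro!: bdd_belowI2 [where m = 0])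
  have c0: "0 \<le> c" unfolding c_def using \<rho>nn by (intro cINF_greatest) auto
  have c_le: "c * Re (cayley \<sigma> z) \<le> Re (q z)" if "z \<in> ball 0 1" for z
  proof -
    have "c \<le> \<rho> z" unfolding c_def using bdd that by (rule cINF_lower)
    then show ?thesis unfolding \<rho>_def using hpos that by (simp add: pos_le_divide_eq)
  qed
  define k where "k = (\<lambda>z. q z - of_real c * cayley \<sigma> z)"
  have holk: "k holomorphic_on ball 0 1"
    unfolding k_def using \<sigma> hol by (intro holomorphic_intros) auto
  have knn: "0 \<le> Re (k z)" if "z \<in> ball 0 1" for z
    using c_le [OF that] by (simp add: k_def)
  define X where "X = (\<lambda>r. k (complex_of_real r * \<sigma>) * complex_of_real (1 - r))"
  have "(X \<longlongrightarrow> 0) (at_left 1)"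
  proof (rule tendstoI)
    fix e :: real assume e: "0 < e"
    \<comment> \<open>At such a \<open>z\<close> the quotient \<open>y\<close> of the remainder is
      below \<open>e / 4\<close>; the bound along the radius tends to \<open>2 * y\<close>, hence
      ends up below \<open>e\<close>.\<close>
    have "\<exists>z\<in>ball 0 1. \<rho> z < c + e / 4"
      using e bdd cINF_less_iff [of "ball 0 1" \<rho> "c + e/4"] by (auto simp: c_def)
    then obtain z where z: "z \<in> ball 0 1" and \<rho>z: "\<rho> z < c + e / 4" by blast
    define y where "y = Re (k z) / Re (cayley \<sigma> z)"
    have kz: "y < e / 4"
    proof -
      have "y = \<rho> z - c"
        using hpos [OF z] by (simp add: y_def k_def \<rho>_def diff_divide_distrib)
      then show ?thesis using \<rho>z by linarith
    qed
    have z2: "0 < 1 - (cmod z)\<^sup>2" using z by (simp add: cmod_less_1_iff)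
    \<comment> \<open>The coefficient of \<open>x = |k w| (1 - r)\<close> in Pick's inequality for
      \<open>w = r \<sigma>\<close>, once both sides are scaled by \<open>1 - r\<close>; the factor
      \<open>1 - r^2\<close> then leaves \<open>1 + r\<close> in the denominator.\<close>
    define T where "T = (\<lambda>r. 4 * Re (k z) * (cmod (1 - cnj (of_real r * \<sigma>) * z))\<^sup>2
        / ((1 - (cmod z)\<^sup>2) * (1 + r)))"
    have "(T \<longlongrightarrow> 4 * Re (k z) * (cmod (1 - cnj (of_real 1 * \<sigma>) * z))\<^sup>2
        / ((1 - (cmod z)\<^sup>2) * (1 + 1))) (at_left 1)"
      unfolding T_def using z2 by (intro tendsto_intros) auto
    moreover have "cmod (1 - cnj \<sigma> * z) = cmod (\<sigma> - z)"
    proof -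
      have "\<sigma> * cnj \<sigma> = 1" using \<sigma> by (simp add: complex_norm_square [symmetric])
      then have "\<sigma> * (1 - cnj \<sigma> * z) = \<sigma> - z" by (simp add: algebra_simps)
      then show ?thesis by (metis \<sigma> mult_1 norm_mult)
    qed
    moreover have "4 * Re (k z) * (cmod (\<sigma> - z))\<^sup>2 / ((1 - (cmod z)\<^sup>2) * (1 + 1))
        = 2 * y"
      unfolding y_def Re_cayley [OF \<sigma>] using z2 by (simp add: divide_simps)
    ultimately have "(T \<longlongrightarrow> 2 * y) (at_left 1)"
      by simp
    then have "((\<lambda>r. T r + 2 * (cmod (k z) * (1 - r))) \<longlongrightarrow>
        2 * y + 2 * (cmod (k z) * (1 - 1))) (at_left 1)"
      by (intro tendsto_intros)
    moreover have "2 * y + 2 * (cmod (k z) * (1 - 1)) < e"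
      using kz e by simp
    ultimately have "\<forall>\<^sub>F r in at_left 1. T r + 2 * (cmod (k z) * (1 - r)) < e"
      by (rule order_tendstoD(2))
    moreover have "\<forall>\<^sub>F r in at_left 1. 0 < r \<and> r < (1::real)"
      by (intro eventually_conj) (auto simp: eventually_at_left_field intro: exI [of _ 0])
    ultimately show "\<forall>\<^sub>F r in at_left 1. dist (X r) 0 < e"
    proof eventually_elim
      case (elim r)
      then have r: "0 < r" "r < 1" by auto
      define w where "w = complex_of_real r * \<sigma>"
      have cw: "cmod w = r" using r \<sigma> by (simp add: w_def norm_mult)
      then have w: "w \<in> ball 0 1" using r by simp
      define x where "x = cmod (X r)"
      have x: "x = cmod (k w) * (1 - r)"
        using r by (simp add: x_def X_def w_def norm_mult del: of_real_diff)
      have "(x - cmod (k z) * (1 - r))\<^sup>2 = (cmod (k w) - cmod (k z))\<^sup>2 * (1 - r)\<^sup>2"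
        unfolding x by (simp add: power_mult_distrib [symmetric] algebra_simps)
      also have "\<dots> \<le> (cmod (k z + cnj (k w)))\<^sup>2 * (1 - r)\<^sup>2"
      proof (intro mult_right_mono)
        have "\<bar>cmod (k w) - cmod (k z)\<bar> \<le> cmod (k z + cnj (k w))"
          using norm_triangle_ineq3 [of "cnj (k w)" "- k z"] by (simp add: add.commute)
        then show "(cmod (k w) - cmod (k z))\<^sup>2 \<le> (cmod (k z + cnj (k w)))\<^sup>2"
          by (simp add: abs_le_square_iff [symmetric])
      qed auto
      also have "\<dots> \<le> T r * x"
      proof -
        have "(cmod (k z + cnj (k w)))\<^sup>2 * ((1 - (cmod z)\<^sup>2) * (1 - r\<^sup>2))
            \<le> 4 * Re (k z) * Re (k w) * (cmod (1 - cnj w * z))\<^sup>2"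
          using pick_inequality [OF holk knn z w] by (simp add: cw)
        also have "\<dots> \<le> 4 * Re (k z) * cmod (k w) * (cmod (1 - cnj w * z))\<^sup>2"
          using knn z by (intro mult_right_mono mult_left_mono complex_Re_le_cmod) auto
        finally have *: "(cmod (k z + cnj (k w)))\<^sup>2 * ((1 - (cmod z)\<^sup>2) * (1 - r\<^sup>2)) * (1 - r)
            \<le> 4 * Re (k z) * cmod (k w) * (cmod (1 - cnj w * z))\<^sup>2 * (1 - r)"
          using r by (intro mult_right_mono) auto
        have "(cmod (k z + cnj (k w)))\<^sup>2 * (1 - r)\<^sup>2 * ((1 - (cmod z)\<^sup>2) * (1 + r))
            = (cmod (k z + cnj (k w)))\<^sup>2 * ((1 - (cmod z)\<^sup>2) * (1 - r\<^sup>2)) * (1 - r)"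
          by (simp add: power2_eq_square algebra_simps)
        also note *
        also have "4 * Re (k z) * cmod (k w) * (cmod (1 - cnj w * z))\<^sup>2 * (1 - r)
            = T r * x * ((1 - (cmod z)\<^sup>2) * (1 + r))"
          using z2 r unfolding T_def x by (simp add: w_def)
        finally show ?thesis using z2 r by (simp add: mult_le_cancel_right)
      qed
      finally have "(x - cmod (k z) * (1 - r))\<^sup>2 \<le> T r * x" .
      then have "x \<le> T r + 2 * (cmod (k z) * (1 - r))"
        by (rule quadratic_bound) (use knn z z2 r in \<open>auto simp: T_def x intro!: divide_nonneg_nonneg mult_nonneg_nonneg\<close>)
      then show ?case using elim by (simp add: x_def)
    qed
  qed
  moreover have "((\<lambda>r. cayley \<sigma> (complex_of_real r * \<sigma>) * complex_of_real (1 - r)) \<longlongrightarrow> 2) (at_left 1)"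
    using tendsto_cayley_radial [OF \<sigma> \<sigma>] by simp
  ultimately have "((\<lambda>r. X r + of_real c * (cayley \<sigma> (complex_of_real r * \<sigma>) * complex_of_real (1 - r)))
      \<longlongrightarrow> 0 + of_real c * 2) (at_left 1)"
    by (intro tendsto_intros)
  then have "((\<lambda>r. q (complex_of_real r * \<sigma>) * complex_of_real (1 - r)) \<longlongrightarrow> complex_of_real (2 * c)) (at_left 1)"
    by (simp add: X_def k_def algebra_simps)
  then show thesis using that c0 c_le by blast
qed

text \<open>Subtracting the atom at one point leaves a function with nonnegative real part and does not
  change the radial limits at the others, so the atoms can be split off one after another.\<close>

lemma julia_wolff_sum:
  assumes hol: "q holomorphic_on ball 0 1" and nn: "\<And>z. z \<in> ball 0 1 \<Longrightarrow> 0 \<le> Re (q z)"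
    and "finite K" "inj_on \<sigma> K" "\<And>k. k \<in> K \<Longrightarrow> cmod (\<sigma> k) = 1"
    and "\<And>k. k \<in> K \<Longrightarrow>
      ((\<lambda>r. q (complex_of_real r * \<sigma> k) * complex_of_real (1 - r)) \<longlongrightarrow> complex_of_real (2 * c k)) (at_left 1)"
    and z: "z \<in> ball 0 1"
  shows "(\<Sum>k\<in>K. c k * Re (cayley (\<sigma> k) z)) \<le> Re (q z)"
  using assms(3-6) z
proof (induction K arbitrary: z rule: finite_induct)
  case empty
  then show ?case using nn by simp
next
  case (insert j K)
  define k where "k = (\<lambda>z. q z - (\<Sum>k\<in>K. of_real (c k) * cayley (\<sigma> k) z))"
  have "\<sigma> i \<notin> ball 0 1" if "i \<in> K" for i using insert.prems that by auto
  then have holk: "k holomorphic_on ball 0 1"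
    unfolding k_def using hol by (intro holomorphic_intros) auto
  have knn: "0 \<le> Re (k z)" if "z \<in> ball 0 1" for z
    using insert.IH [OF _ _ _ that] insert.prems by (simp add: k_def inj_on_insert)
  have \<sigma>j: "cmod (\<sigma> j) = 1" using insert.prems by simp
  obtain d where d: "((\<lambda>r. k (complex_of_real r * \<sigma> j) * complex_of_real (1 - r)) \<longlongrightarrow> complex_of_real (2 * d)) (at_left 1)"
    "\<And>z. z \<in> ball 0 1 \<Longrightarrow> d * Re (cayley (\<sigma> j) z) \<le> Re (k z)"
    using julia_wolff [OF holk knn \<sigma>j] by metis
  have "((\<lambda>r. q (complex_of_real r * \<sigma> j) * complex_of_real (1 - r)
      - (\<Sum>k\<in>K. of_real (c k) * (cayley (\<sigma> k) (complex_of_real r * \<sigma> j) * complex_of_real (1 - r))))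
      \<longlongrightarrow> complex_of_real (2 * c j) - (\<Sum>k\<in>K. of_real (c k) * (if \<sigma> k = \<sigma> j then 2 else 0))) (at_left 1)"
    using insert.prems by (intro tendsto_intros tendsto_cayley_radial) auto
  moreover have "(\<Sum>k\<in>K. complex_of_real (c k) * (if \<sigma> k = \<sigma> j then 2 else 0)) = 0"
    using insert.prems insert.hyps by (intro sum.neutral) (auto simp: inj_on_def)
  moreover have "(\<lambda>r. q (complex_of_real r * \<sigma> j) * complex_of_real (1 - r)
      - (\<Sum>k\<in>K. of_real (c k) * (cayley (\<sigma> k) (complex_of_real r * \<sigma> j) * complex_of_real (1 - r))))
      = (\<lambda>r. k (complex_of_real r * \<sigma> j) * complex_of_real (1 - r))"
    by (simp add: k_def left_diff_distrib sum_distrib_right mult.assoc)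
  ultimately have "complex_of_real (2 * d) = complex_of_real (2 * c j)"
    using tendsto_unique [OF _ d(1)] by (simp add: trivial_limit_at_left_real)
  then have "d = c j" by (simp only: of_real_eq_iff)
  then show ?case using d(2) [OF insert.prems(4)] insert.hyps by (simp add: k_def)
qed

text \<open>Schwarz's lemma for the Cayley transform \<open>F\<close> of \<open>q\<close> centred at
  \<open>q 0\<close>, whose derivative at 0 is \<open>deriv q 0 / (2 Re (q 0))\<close>. Equality
  makes \<open>F\<close> a rotation by \<open>\<alpha>\<close>, and solving
  \<open>F z = \<alpha> z\<close> for \<open>q\<close> gives the kernel at
  \<open>cnj \<alpha>\<close>.\<close>

lemma caratheodory_coefficient:
  assumes hol: "q holomorphic_on ball 0 1" and nn: "\<And>z. z \<in> ball 0 1 \<Longrightarrow> 0 \<le> Re (q z)"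
  shows "cmod (deriv q 0) \<le> 2 * Re (q 0)"
    and "cmod (deriv q 0) = 2 * Re (q 0) \<Longrightarrow>
      \<exists>s. cmod s = 1 \<and> (\<forall>z\<in>ball 0 1. q z = of_real (Re (q 0)) * cayley s z + \<i> * of_real (Im (q 0)))"
proof -
  have "cmod (deriv q 0) \<le> 2 * Re (q 0) \<and> (cmod (deriv q 0) = 2 * Re (q 0) \<longrightarrow>
      (\<exists>s. cmod s = 1 \<and> (\<forall>z\<in>ball 0 1. q z = of_real (Re (q 0)) * cayley s z + \<i> * of_real (Im (q 0)))))"
    (is "?A \<and> ?B")
  proof (cases "\<exists>b. \<forall>z\<in>ball 0 1. q z = \<i> * complex_of_real b")
    case True
    then obtain b where b: "\<And>z. z \<in> ball 0 1 \<Longrightarrow> q z = \<i> * complex_of_real b" by blast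
    have "\<forall>\<^sub>F z in nhds 0. q z = \<i> * complex_of_real b"
      using b by (intro eventually_nhds_in_open [of "ball 0 1", THEN eventually_mono]) auto
    then have "deriv q 0 = deriv (\<lambda>z. \<i> * complex_of_real b) 0"
      by (rule deriv_cong_ev) simp
    then have "deriv q 0 = 0" by simp
    \<comment> \<open>Here \<open>Re (q 0) = 0\<close>, so the kernel drops out and any unimodular
      point serves.\<close>
    then show ?thesis using b by (auto intro!: exI [of _ 1])
  next
    case False
    then have pos: "0 < Re (q z)" if "z \<in> ball 0 1" for z
      using nonneg_Re_dichotomy hol nn that by blast
    have q0: "0 < Re (q 0)" using pos by simp
    define F where "F = (\<lambda>z. (q z - q 0) / (q z + cnj (q 0)))"
    have ne: "q z + cnj (q 0) \<noteq> 0" if "z \<in> ball 0 1" for z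
      using cayley_quotient_bound(2) [OF pos [OF that] q0] .
    have holF: "F holomorphic_on ball 0 1"
      unfolding F_def using ne hol by (intro holomorphic_intros) auto
    have F0: "F 0 = 0" by (simp add: F_def)
    have F1: "cmod (F z) < 1" if "cmod z < 1" for z
      unfolding F_def using cayley_quotient_bound(1) pos q0 that by simp
    have twice: "q 0 + cnj (q 0) = of_real (2 * Re (q 0))" by (simp add: complex_add_cnj)
    have "(q has_field_derivative deriv q 0) (at 0)"
      using hol by (rule holomorphic_derivI) auto
    then have "(F has_field_derivative deriv q 0 / (q 0 + cnj (q 0))) (at 0)"
      unfolding F_def using ne [of 0]
      by (auto intro!: derivative_eq_intros)
    then have "deriv F 0 = deriv q 0 / of_real (2 * Re (q 0))"
      unfolding twice by (rule DERIV_imp_deriv)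
    then have dF: "cmod (deriv F 0) = cmod (deriv q 0) / (2 * Re (q 0))"
      using q0 by (simp add: norm_divide norm_mult)
    have ?A
      using Schwarz_Lemma(2) [OF holF F0 F1, of 0] q0 unfolding dF by (simp add: divide_simps)
    moreover have ?B
    proof
      assume "cmod (deriv q 0) = 2 * Re (q 0)"
      then have "cmod (deriv F 0) = 1" using q0 by (simp add: dF)
      then obtain \<alpha> where \<alpha>: "\<And>z. cmod z < 1 \<Longrightarrow> F z = \<alpha> * z" "cmod \<alpha> = 1"
        using Schwarz_Lemma(3) [OF holF F0 F1, of 0] by auto
      have \<alpha>c: "\<alpha> * cnj \<alpha> = 1" using \<alpha>(2) by (simp add: complex_norm_square [symmetric])
      have "q z = of_real (Re (q 0)) * cayley (cnj \<alpha>) z + \<i> * of_real (Im (q 0))" if z: "z \<in> ball 0 1" for z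
      proof -
        have lt: "cmod (\<alpha> * z) < 1" using z \<alpha> by (simp add: norm_mult)
        then have ne1: "1 - \<alpha> * z \<noteq> 0" by auto
        have "q z - q 0 = \<alpha> * z * (q z + cnj (q 0))"
          using \<alpha>(1) [of z] z ne [OF z] by (simp add: F_def divide_simps)
        then have "q z * (1 - \<alpha> * z) = q 0 + \<alpha> * z * cnj (q 0)"
          by (simp add: algebra_simps)
        also have "\<dots> = of_real (Re (q 0)) * (1 + \<alpha> * z) + \<i> * of_real (Im (q 0)) * (1 - \<alpha> * z)"
          by (simp add: complex_eq_iff algebra_simps)
        finally have "q z = of_real (Re (q 0)) * ((1 + \<alpha> * z) / (1 - \<alpha> * z)) + \<i> * of_real (Im (q 0))"
          using ne1 by (simp add: divide_simps)
        moreover have "(1 + \<alpha> * z) / (1 - \<alpha> * z) = cayley (cnj \<alpha>) z"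
        proof -
          have "1 + \<alpha> * z = \<alpha> * (cnj \<alpha> + z)" "1 - \<alpha> * z = \<alpha> * (cnj \<alpha> - z)"
            using \<alpha>c by (auto simp: algebra_simps)
          then show ?thesis using \<alpha>(2) by (auto simp: cayley_def)
        qed
        ultimately show ?thesis by simp
      qed
      then show "\<exists>s. cmod s = 1 \<and> (\<forall>z\<in>ball 0 1. q z = of_real (Re (q 0)) * cayley s z + \<i> * of_real (Im (q 0)))"
        using \<alpha>(2) by (metis complex_mod_cnj)
    qed
    ultimately show ?thesis ..
  qed
  then show "cmod (deriv q 0) \<le> 2 * Re (q 0)"
    and "cmod (deriv q 0) = 2 * Re (q 0) \<Longrightarrow>
      \<exists>s. cmod s = 1 \<and> (\<forall>z\<in>ball 0 1. q z = of_real (Re (q 0)) * cayley s z + \<i> * of_real (Im (q 0)))"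
    by blast+
qed

section \<open>Existence of the flow\<close>

text \<open>Split \<open>q = q 0 + z k z\<close>. Under \<open>z = exp (- u)\<close> the constant
  integrates to \<open>q 0 * u\<close>, and the rest to a primitive \<open>R\<close> of
  \<open>k\<close> evaluated at \<open>exp (- u)\<close>, which is periodic. Only the linear term
  feels a shift by a multiple of \<open>2 pi i\<close>.\<close>

lemma half_plane_primitive:
  assumes hol: "q holomorphic_on ball 0 1"
  obtains Q where
    "\<And>u. 0 < Re u \<Longrightarrow> (Q has_field_derivative q (exp (- u))) (at u)"
    "\<And>u k. Q (u + of_real (2 * pi * of_int k) * \<i>) = Q u + of_real (2 * pi * of_int k) * \<i> * q 0"
proof -
  define k where "k = (\<lambda>z. if z = 0 then deriv q 0 else (q z - q 0) / (z - 0))"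
  have "k holomorphic_on ball 0 1"
    unfolding k_def using hol by (rule pole_lemma) auto
  then obtain R where R: "\<And>z. z \<in> ball 0 1 \<Longrightarrow> (R has_field_derivative k z) (at z within ball 0 1)"
    using holomorphic_convex_primitive' [OF convex_ball open_ball] by blast
  define Q where "Q = (\<lambda>u. q 0 * u - R (exp (- u)))"
  show thesis
  proof (rule that)
    fix u :: complex assume u: "0 < Re u"
    then have b: "exp (- u) \<in> ball 0 1" by simp
    then have "(R has_field_derivative k (exp (- u))) (at (exp (- u)))"
      using R [OF b] by (simp add: at_within_open [OF b])
    then have "(Q has_field_derivative q 0 - k (exp (- u)) * (exp (- u) * (- 1))) (at u)"
      unfolding Q_def by (auto intro!: derivative_eq_intros DERIV_chain2 [of R])
    moreover have "q 0 - k (exp (- u)) * (exp (- u) * (- 1)) = q (exp (- u))"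
      by (simp add: k_def)
    ultimately show "(Q has_field_derivative q (exp (- u))) (at u)" by simp
  next
    fix u :: complex and k :: int
    have "exp (- (u + of_real (2 * pi * of_int k) * \<i>)) = exp (- u)"
      by (simp add: exp_eq) (rule exI [of _ "- k"], simp)
    then show "Q (u + of_real (2 * pi * of_int k) * \<i>) = Q u + of_real (2 * pi * of_int k) * \<i> * q 0"
      unfolding Q_def by (simp add: algebra_simps)
  qed
qed

text \<open>In the coordinate \<open>u = - ln z\<close> the equation \<open>z' = - z / q z\<close> reads
  \<open>Q u = Q u\<^sub>0 + t\<close> with \<open>Q' u = q (exp (- u))\<close>. As \<open>Re Q' > 0\<close> on a convex domain, \<open>Q\<close> is
  injective there; the periodicity makes the flow independent of the branch of the logarithm.\<close>

locale half_plane_model =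
  fixes q Q :: "complex \<Rightarrow> complex"
  assumes hol: "q holomorphic_on ball 0 1"
    and pos: "z \<in> ball 0 1 \<Longrightarrow> 0 < Re (q z)"
    and deriv_Q: "0 < Re u \<Longrightarrow> (Q has_field_derivative q (exp (- u))) (at u)"
    and period_Q: "Q (u + of_real (2 * pi * of_int k) * \<i>) = Q u + of_real (2 * pi * of_int k) * \<i> * q 0"
begin

abbreviation half_plane :: "complex set" where
  "half_plane \<equiv> {u. 0 < Re u}"

lemma Q_holomorphic: "Q holomorphic_on half_plane"
  using deriv_Q by (intro holomorphic_onI) (auto simp: field_differentiable_def intro: DERIV_subset)

text \<open>The Noshiro-Warschawski argument made quantitative: apply the mean value theorem to
  \<open>Re (cnj (b - a) * Q)\<close> along the segment. The constant \<open>m\<close> is the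
  minimum of \<open>Re q\<close> on the closed disk of radius \<open>exp (- \<delta>)\<close>. It
  serves both injectivity and the limit argument in \<open>image_Q_right_translate\<close>.\<close>

lemma Q_expands:
  assumes "0 < \<delta>"
  obtains m where "0 < m"
    "\<And>a b. \<delta> \<le> Re a \<Longrightarrow> \<delta> \<le> Re b \<Longrightarrow> m * cmod (b - a) \<le> cmod (Q b - Q a)"
proof -
  have "exp (- \<delta>) < 1" using assms by simp
  then have sub: "cball 0 (exp (- \<delta>)) \<subseteq> ball (0::complex) 1"
    by (simp add: cball_subset_ball_iff)
  have "continuous_on (cball 0 (exp (- \<delta>))) (\<lambda>z. Re (q z))"
    using holomorphic_on_imp_continuous_on [OF hol] sub
    by (intro continuous_intros) (rule continuous_on_subset)
  then obtain z0 where z0: "z0 \<in> cball 0 (exp (- \<delta>))"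
    "\<And>z. z \<in> cball 0 (exp (- \<delta>)) \<Longrightarrow> Re (q z0) \<le> Re (q z)"
    using continuous_attains_inf [of "cball 0 (exp (- \<delta>))" "\<lambda>z. Re (q z)"] by auto
  have "Re (q z0) * cmod (b - a) \<le> cmod (Q b - Q a)" if a: "\<delta> \<le> Re a" and b: "\<delta> \<le> Re b" for a b
  proof (cases "a = b")
    case False
    define x where "x = (\<lambda>s. a + of_real s * (b - a))"
    have x: "\<delta> \<le> Re (x s)" if "0 \<le> s" "s \<le> 1" for s
    proof -
      have "Re (x s) = (1 - s) * Re a + s * Re b" by (simp add: x_def algebra_simps)
      moreover have "(1 - s) * \<delta> \<le> (1 - s) * Re a" "s * \<delta> \<le> s * Re b"
        using that a b by (auto intro: mult_left_mono)
      ultimately show ?thesis by (simp add: algebra_simps)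
    qed
    have der: "((\<lambda>s. Re (cnj (b - a) * Q (x s))) has_real_derivative
        (cmod (b - a))\<^sup>2 * Re (q (exp (- x s)))) (at s)" if "0 \<le> s" "s \<le> 1" for s
    proof -
      have "(Q has_field_derivative q (exp (- x s))) (at (x s))"
        using deriv_Q x [OF that] assms by simp
      moreover have "(x has_vector_derivative (b - a)) (at s)"
        unfolding x_def by (auto intro!: derivative_eq_intros)
      ultimately have "((Q \<circ> x) has_vector_derivative (b - a) * q (exp (- x s))) (at s)"
        by (rule field_vector_diff_chain_at [rotated])
      then have "((\<lambda>s. Re (cnj (b - a) * Q (x s))) has_vector_derivative
          Re (cnj (b - a) * ((b - a) * q (exp (- x s))))) (at s)"
        unfolding comp_def
        by (intro bounded_linear.has_vector_derivative [OF bounded_linear_Re] has_vector_derivative_mult_right)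
      moreover have "cnj (b - a) * ((b - a) * q (exp (- x s))) = of_real ((cmod (b - a))\<^sup>2) * q (exp (- x s))"
        by (simp only: complex_norm_square mult.assoc mult.commute mult.left_commute)
      ultimately show ?thesis
        by (simp add: has_real_derivative_iff_has_vector_derivative del: of_real_power complex_cnj_diff)
    qed
    obtain s where s: "0 < s" "s < 1" and
      eq: "Re (cnj (b - a) * Q (x 1)) - Re (cnj (b - a) * Q (x 0))
        = (1 - 0) * ((cmod (b - a))\<^sup>2 * Re (q (exp (- x s))))"
      using MVT2 [of 0 1 "\<lambda>s. Re (cnj (b - a) * Q (x s))" "\<lambda>s. (cmod (b - a))\<^sup>2 * Re (q (exp (- x s)))"] der
      by auto
    have "exp (- x s) \<in> cball 0 (exp (- \<delta>))"
      using x [of s] s by simp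
    then have "(cmod (b - a))\<^sup>2 * Re (q z0) \<le> (cmod (b - a))\<^sup>2 * Re (q (exp (- x s)))"
      using z0(2) by (intro mult_left_mono) auto
    also have "\<dots> = Re (cnj (b - a) * (Q b - Q a))"
      using eq by (simp add: x_def algebra_simps)
    also have "\<dots> \<le> cmod (b - a) * cmod (Q b - Q a)"
      by (metis complex_Re_le_cmod norm_mult complex_mod_cnj)
    finally have "cmod (b - a) * (Re (q z0) * cmod (b - a)) \<le> cmod (b - a) * cmod (Q b - Q a)"
      by (simp add: power2_eq_square mult_ac)
    then show ?thesis using False by simp
  qed auto
  then show thesis using that pos z0 sub by blast
qed

lemma inj_Q: "inj_on Q half_plane"
proof (rule inj_onI)
  fix a b assume "a \<in> half_plane" "b \<in> half_plane" and eq: "Q a = Q b"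
  then have "0 < min (Re a) (Re b)" by simp
  then obtain m where "0 < m" "m * cmod (b - a) \<le> cmod (Q b - Q a)"
    using Q_expands [of "min (Re a) (Re b)"] by (metis min.cobounded1 min.cobounded2)
  then show "a = b" using eq by (simp add: mult_le_0_iff)
qed

definition Qinv :: "complex \<Rightarrow> complex" where
  "Qinv = the_inv_into half_plane Q"

lemma Qinv_Q: "0 < Re u \<Longrightarrow> Qinv (Q u) = u"
  unfolding Qinv_def using inj_Q by (simp add: the_inv_into_f_f)

lemma open_image_Q: "open (Q ` half_plane)"
  using open_mapping_thm3 [OF Q_holomorphic _ inj_Q] open_halfspace_Re_gt by blast

lemma deriv_Qinv:
  assumes "0 < Re u"
  shows "(Qinv has_field_derivative 1 / q (exp (- u))) (at (Q u))"
proof -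
  obtain g where g: "g holomorphic_on Q ` half_plane"
    "\<And>z. z \<in> half_plane \<Longrightarrow> deriv Q z * deriv g (Q z) = 1"
    "\<And>z. z \<in> half_plane \<Longrightarrow> g (Q z) = z"
    using holomorphic_has_inverse [OF Q_holomorphic _ inj_Q] open_halfspace_Re_gt by blast
  have "(g has_field_derivative deriv g (Q u)) (at (Q u))"
    using holomorphic_derivI [OF g(1) open_image_Q] assms by auto
  moreover have "deriv g (Q u) = 1 / q (exp (- u))"
    using g(2) [of u] assms DERIV_imp_deriv [OF deriv_Q [OF assms]]
    by (metis (no_types, lifting) mem_Collect_eq mult_zero_left nonzero_eq_divide_eq mult.commute zero_neq_one)
  moreover have "g w = Qinv w" if "w \<in> Q ` half_plane" for w
    using that g(3) Qinv_Q by auto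
  ultimately show ?thesis
    using has_field_derivative_transform_within_open [OF _ open_image_Q] assms by (metis (no_types, lifting) imageI mem_Collect_eq)
qed

text \<open>This is global existence of the flow, by continuation: the set \<open>S\<close> of
  reachable times is closed because \<open>Q\<close> expands distances, and it cannot stop at a
  \<open>T < t\<close> because the image of \<open>Q\<close> is open. Demanding
  \<open>Re u \<le> Re v\<close> keeps solutions away from the imaginary axis.\<close>

lemma image_Q_right_translate:
  assumes u: "0 < Re u" and t: "0 \<le> t"
  obtains v where "Re u \<le> Re v" "Q v = Q u + of_real t"
proof -
  define S where "S = {s \<in> {0..t}. \<exists>v. Re u \<le> Re v \<and> Q v = Q u + of_real s}"
  obtain m where m: "0 < m" "\<And>a b. Re u \<le> Re a \<Longrightarrow> Re u \<le> Re b \<Longrightarrow> m * cmod (b - a) \<le> cmod (Q b - Q a)"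
    using Q_expands [OF u] by blast
  have "0 \<in> S" using t by (auto simp: S_def)
  have bdd: "bdd_above S" by (auto simp: S_def intro!: bdd_aboveI [of _ t])
  define T where "T = Sup S"
  have "closed S"
    unfolding closed_sequential_limits
  proof (intro allI impI, elim conjE)
    fix x l assume xS: "\<forall>n. x n \<in> S" and xl: "x \<longlonglongrightarrow> l"
    have l: "l \<in> {0..t}"
      using closed_sequentially [OF closed_atLeastAtMost _ xl] xS by (auto simp: S_def)
    obtain v where v: "\<And>n. Re u \<le> Re (v n)" "\<And>n. Q (v n) = Q u + of_real (x n)"
      using xS unfolding S_def by simp metis
    \<comment> \<open>All \<open>v n\<close> lie in one half-plane on which \<open>Q\<close> expands
      with the same \<open>m\<close>, so convergence of the times transfers to the points.\<close>
    have "Cauchy v"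
    proof (rule CauchyI)
      fix e :: real assume "0 < e"
      then have "0 < m * e" using m by simp
      then obtain N where N: "\<And>i j. N \<le> i \<Longrightarrow> N \<le> j \<Longrightarrow> norm (x i - x j) < m * e"
        using LIMSEQ_imp_Cauchy [OF xl] by (meson CauchyD)
      have "norm (v i - v j) < e" if "N \<le> i" "N \<le> j" for i j
      proof -
        have "m * cmod (v i - v j) \<le> cmod (Q (v i) - Q (v j))" using m(2) v(1) by blast
        also have "\<dots> = norm (x i - x j)" unfolding v(2) by (simp flip: of_real_diff)
        also have "\<dots> < m * e" using N that by blast
        finally show ?thesis using m by simp
      qed
      then show "\<exists>N. \<forall>i\<ge>N. \<forall>j\<ge>N. norm (v i - v j) < e" by blast
    qed
    then obtain w where w: "v \<longlonglongrightarrow> w" using Cauchy_convergent convergentD by blast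
    have "Re u \<le> Re w"
      using tendsto_Re [OF w] v(1) by (intro tendsto_lowerbound [of "\<lambda>n. Re (v n)"]) auto
    moreover have "isCont Q w"
      using calculation u deriv_Q DERIV_isCont by (metis less_le_trans)
    then have "(\<lambda>n. Q (v n)) \<longlonglongrightarrow> Q w" using w isCont_tendsto_compose by blast
    moreover have "(\<lambda>n. Q (v n)) \<longlonglongrightarrow> Q u + of_real l"
      unfolding v(2) using xl by (intro tendsto_intros)
    ultimately show "l \<in> S" using l LIMSEQ_unique unfolding S_def by blast
  qed
  then have TS: "T \<in> S" unfolding T_def using bdd \<open>0 \<in> S\<close> closed_contains_Sup by blast
  then obtain v where v: "Re u \<le> Re v" "Q v = Q u + of_real T" and Tt: "0 \<le> T" "T \<le> t" by (auto simp: S_def)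
  show thesis
  proof (cases "T = t")
    case True
    then show thesis using that v by blast
  next
    case False
    then have "T < t" using Tt by simp
    have v0: "0 < Re v" using u v by simp
    have "0 < Re (q (exp (- v)))" using pos v0 by simp
    \<comment> \<open>\<open>Qinv\<close> has derivative \<open>1 / q\<close>, so a translation to
      the right increases the real part of the preimage; the constraint in \<open>S\<close>
      therefore survives beyond \<open>T\<close>.\<close>
    then have rp: "0 < Re (1 / q (exp (- v)))" by (simp add: Re_complex_div_gt_0)
    have "((\<lambda>s. Q u + complex_of_real s) has_vector_derivative 1) (at T)"
      by (auto intro!: derivative_eq_intros)
    then have "((\<lambda>s. Qinv (Q u + of_real s)) has_vector_derivative 1 * (1 / q (exp (- v)))) (at T)"
      using field_vector_diff_chain_at [of "\<lambda>s. Q u + complex_of_real s" 1 T Qinv] deriv_Qinv [OF v0] v(2)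
      by (simp add: comp_def)
    then have "((\<lambda>s. Re (Qinv (Q u + of_real s))) has_real_derivative Re (1 / q (exp (- v)))) (at T)"
      unfolding has_real_derivative_iff_has_vector_derivative
      using bounded_linear.has_vector_derivative [OF bounded_linear_Re] by fastforce
    then obtain d where d: "0 < d" "\<And>h. 0 < h \<Longrightarrow> h < d \<Longrightarrow> Re (Qinv (Q u + of_real T)) < Re (Qinv (Q u + of_real (T + h)))"
      using DERIV_pos_inc_right [OF _ rp] by blast
    obtain e where e: "0 < e" "ball (Q v) e \<subseteq> Q ` half_plane"
      using open_image_Q v0 by (metis (mono_tags) imageI mem_Collect_eq openE)
    define h where "h = Min {d / 2, e / 2, t - T}"
    have h: "0 < h" "h < d" "h < e" "h \<le> t - T" using d e \<open>T < t\<close> by (auto simp: h_def)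
    have "Q v + of_real h \<in> ball (Q v) e" using h by (simp add: dist_norm)
    then obtain w where w: "0 < Re w" "Q w = Q v + of_real h" using e by (auto simp: subset_iff)
    have "Qinv (Q u + of_real (T + h)) = w" "Qinv (Q u + of_real T) = v"
      using Qinv_Q [OF w(1)] Qinv_Q [OF v0] w(2) v(2) by (auto simp: add.assoc)
    then have "Re v < Re w" using d h by metis
    then have "T + h \<in> S" using h v w Tt by (auto simp: S_def intro!: exI [of _ w])
    then have "T + h \<le> T" unfolding T_def using bdd cSup_upper by blast
    then show thesis using h by simp
  qed
qed

definition shift :: "real \<Rightarrow> complex \<Rightarrow> complex" where
  "shift t u = Qinv (Q u + of_real t)"

lemma shift:
  assumes "0 < Re u" "0 \<le> t"
  shows "Re u \<le> Re (shift t u)" "Q (shift t u) = Q u + of_real t"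
proof -
  obtain v where v: "Re u \<le> Re v" "Q v = Q u + of_real t"
    using image_Q_right_translate assms by blast
  then have "shift t u = v" using Qinv_Q [of v] assms by (simp add: shift_def)
  then show "Re u \<le> Re (shift t u)" "Q (shift t u) = Q u + of_real t" using v by auto
qed

lemma shift_0: "0 < Re u \<Longrightarrow> shift 0 u = u"
  by (simp add: shift_def Qinv_Q)

lemma shift_add:
  assumes "0 < Re u" "0 \<le> s" "0 \<le> t"
  shows "shift (s + t) u = shift s (shift t u)"
  using shift [OF assms(1,3)] by (simp add: shift_def add_ac)

text \<open>Translating \<open>u\<close> by a period changes \<open>Q\<close> by an amount
  independent of \<open>u\<close>, so \<open>shift t\<close> commutes with translation by
  periods.\<close>

lemma exp_shift_cong:
  assumes u: "0 < Re u" and t: "0 \<le> t" and eq: "exp (- u) = exp (- v)"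
  shows "exp (- shift t u) = exp (- shift t v)"
proof -
  obtain k where "- u = - v + of_int (2 * k) * pi * \<i>" using eq by (auto simp: exp_eq)
  then have v: "v = u + of_real (2 * pi * of_int k) * \<i>" by (simp add: algebra_simps)
  let ?p = "of_real (2 * pi * of_int k) * \<i>"
  have r: "0 < Re (shift t u + ?p)" using shift(1) [OF u t] u by simp
  have "Q v + of_real t = Q (shift t u + ?p)"
    using shift(2) [OF u t] by (simp only: v period_Q) simp
  then have "shift t v = shift t u + ?p" using Qinv_Q [OF r] by (simp add: shift_def)
  then have "exp (- shift t u) = exp (- (shift t v) + ?p)" by simp
  also have "\<dots> = exp (- shift t v)"
    by (simp add: exp_eq)
  finally show ?thesis .
qed

text \<open>The origin corresponds to \<open>Re u\<close> tending to infinity and is filled in by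
  hand. The principal branch of \<open>Ln\<close> is only a choice, harmless by
  \<open>exp_shift_cong\<close>.\<close>

definition flow :: "real \<Rightarrow> complex \<Rightarrow> complex" where
  "flow t z = (if z = 0 then 0 else exp (- shift t (- Ln z)))"

lemma flow_0 [simp]: "flow t 0 = 0"
  by (simp add: flow_def)

lemma Re_minus_Ln_pos: "z \<in> ball 0 1 \<Longrightarrow> z \<noteq> 0 \<Longrightarrow> 0 < Re (- Ln z)"
  by (simp add: Re_Ln)

lemma flow_exp:
  assumes "0 < Re u" "0 \<le> t"
  shows "flow t (exp (- u)) = exp (- shift t u)"
proof -
  have "flow t (exp (- u)) = exp (- shift t (- Ln (exp (- u))))" by (simp add: flow_def)
  also have "\<dots> = exp (- shift t u)"
    using assms by (intro exp_shift_cong) (auto simp: Re_Ln)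
  finally show ?thesis .
qed

lemma disk_cases:
  assumes "z \<in> ball 0 1"
  obtains "z = 0" | u where "0 < Re u" "z = exp (- u)"
proof (cases "z = 0")
  case False
  then have "0 < Re (- Ln z)" "z = exp (- (- Ln z))" using assms Re_minus_Ln_pos by auto
  then show thesis using that by blast
qed (use that in auto)

lemma norm_flow_le:
  assumes "z \<in> ball 0 1" "0 \<le> t"
  shows "cmod (flow t z) \<le> cmod z"
  using assms(1)
proof (cases rule: disk_cases)
  case (2 u)
  then show ?thesis using flow_exp shift(1) assms by simp
qed simp

lemma flow_holomorphic:
  assumes t: "0 \<le> t"
  shows "flow t holomorphic_on ball 0 1"
proof -
  have diff: "flow t field_differentiable at z0" if z0: "z0 \<in> ball 0 1" "z0 \<noteq> 0" for z0
  proof -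
    \<comment> \<open>A branch of the negative logarithm that is holomorphic near \<open>z0\<close>;
      the principal \<open>Ln\<close> itself would fail on the negative real axis.\<close>
    define u where "u = (\<lambda>z. - Ln z0 - Ln (z / z0))"
    have u0: "u z0 = - Ln z0" using z0 by (simp add: u_def)
    have Re0: "0 < Re (u z0)" using z0 Re_minus_Ln_pos by (simp add: u0)
    have du: "(u has_field_derivative - (1 / z0)) (at z0)"
      unfolding u_def using z0 by (auto intro!: derivative_eq_intros)
    have "isCont u z0" using du DERIV_isCont by blast
    have exp_u: "exp (- u z) = z" if "z \<noteq> 0" for z
      using that z0 by (simp add: u_def exp_add exp_diff)
    have "(Qinv has_field_derivative 1 / q (exp (- shift t (u z0)))) (at (Q (u z0) + of_real t))"
      using deriv_Qinv [of "shift t (u z0)"] shift [OF Re0 t] Re0 by simp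
    moreover have "((\<lambda>z. Q (u z) + of_real t) has_field_derivative q (exp (- u z0)) * - (1 / z0) + 0) (at z0)"
      using DERIV_chain2 [OF deriv_Q [OF Re0] du] by (intro DERIV_add DERIV_const)
    ultimately have "((\<lambda>z. Qinv (Q (u z) + of_real t)) has_field_derivative
       1 / q (exp (- shift t (u z0))) * (q (exp (- u z0)) * - (1 / z0) + 0)) (at z0)"
      by (rule DERIV_chain2)
    then have "(\<lambda>z. exp (- shift t (u z))) field_differentiable at z0"
      unfolding shift_def field_differentiable_def
      by (intro exI) (rule derivative_eq_intros refl | assumption)+
    moreover have "\<forall>\<^sub>F z in nhds z0. exp (- shift t (u z)) = flow t z"
    proof -
      have "\<forall>\<^sub>F z in nhds z0. 0 < Re (u z)"
        using \<open>isCont u z0\<close> Re0 order_tendstoD(1) [of "\<lambda>z. Re (u z)" "Re (u z0)" "nhds z0" 0]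
        by (auto simp: isCont_def tendsto_at_iff_tendsto_nhds intro: tendsto_Re)
      moreover have "\<forall>\<^sub>F z in nhds z0. z \<noteq> 0"
        using z0 by (simp add: t1_space_nhds)
      ultimately show ?thesis
        by eventually_elim (use flow_exp exp_u t in metis)
    qed
    ultimately show ?thesis
      unfolding field_differentiable_def by (metis DERIV_cong_ev)
  qed
  \<comment> \<open>At 0, continuity comes from \<open>|flow t z| \<le> |z|\<close>; the singularity
    is then removable.\<close>
  have "isCont (flow t) z" if z: "z \<in> ball 0 1" for z
  proof (cases "z = 0")
    case True
    have "(flow t \<longlongrightarrow> 0) (at 0)"
    proof (rule Lim_null_comparison)
      show "\<forall>\<^sub>F z in at 0. cmod (flow t z) \<le> cmod z"
        using norm_flow_le t by (intro eventually_at_in_open' [of "ball 0 1", THEN eventually_mono]) auto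
      show "((\<lambda>z::complex. cmod z) \<longlongrightarrow> 0) (at 0)"
        by (intro tendsto_eq_intros) auto
    qed
    then show ?thesis using True by (simp add: isCont_def)
  next
    case False
    then show ?thesis using diff z field_differentiable_imp_continuous_at by blast
  qed
  then have "continuous_on (ball 0 1) (flow t)"
    by (simp add: continuous_at_imp_continuous_on)
  moreover have "flow t holomorphic_on (ball 0 1 - {0})"
    using diff by (intro holomorphic_onI) (auto intro: field_differentiable_at_within)
  ultimately show ?thesis
    by (rule no_isolated_singularity) auto
qed

lemma flow_add:
  assumes "z \<in> ball 0 1" "0 \<le> s" "0 \<le> t"
  shows "flow (s + t) z = flow s (flow t z)"
  using assms(1)
proof (cases rule: disk_cases)
  case (2 u)
  then have "0 < Re (shift t u)" using shift(1) assms less_le_trans by blast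
  then show ?thesis using 2 assms by (simp add: flow_exp shift_add)
qed simp

lemma flow_vector_derivative:
  assumes z: "z \<in> ball 0 1" and t: "0 \<le> t"
  shows "((\<lambda>s. flow s z) has_vector_derivative - flow t z / q (flow t z)) (at t within {0..})"
  using z
proof (cases rule: disk_cases)
  case (2 u)
  let ?v = "shift t u"
  have v: "0 < Re ?v" using shift(1) [OF 2(1) t] 2(1) by linarith
  have "((\<lambda>w. exp (- Qinv w)) has_field_derivative exp (- ?v) * - (1 / q (exp (- ?v)))) (at (Q u + of_real t))"
    using deriv_Qinv [OF v] shift(2) [OF 2(1) t] unfolding shift_def
    by (auto intro!: derivative_eq_intros)
  moreover have "((\<lambda>s. Q u + complex_of_real s) has_vector_derivative 1) (at t)"
    by (auto intro!: derivative_eq_intros)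
  ultimately have "(((\<lambda>w. exp (- Qinv w)) \<circ> (\<lambda>s. Q u + complex_of_real s)) has_vector_derivative
      1 * (exp (- ?v) * - (1 / q (exp (- ?v))))) (at t)"
    by (intro field_vector_diff_chain_at)
  then have "((\<lambda>s. exp (- shift s u)) has_vector_derivative - flow t z / q (flow t z)) (at t within {0..})"
    using 2 t by (simp add: comp_def shift_def flow_exp has_vector_derivative_at_within)
  then show ?thesis
    by (rule has_vector_derivative_transform [rotated 2]) (use 2 t flow_exp in auto)
qed simp

lemma generates_flow: "generates (\<lambda>z. - z / q z) flow"
  unfolding generates_def is_semigroup_def unit_disk_def
proof (intro conjI allI impI ballI)
  fix t :: real assume t: "0 \<le> t"
  show "flow t holomorphic_on ball 0 1" by (rule flow_holomorphic [OF t])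
  show "flow t ` ball 0 1 \<subseteq> ball 0 1"
    using norm_flow_le [OF _ t] by (auto simp: image_subset_iff) (meson le_less_trans)
next
  fix z :: complex assume z: "z \<in> ball 0 1"
  show f0: "flow 0 z = z"
    using z by (cases rule: disk_cases) (auto simp: flow_exp shift_0)
  have "continuous (at 0 within {0..}) (\<lambda>t. flow t z)"
    using flow_vector_derivative [OF z order_refl] by (rule has_vector_derivative_continuous)
  then have "((\<lambda>t. flow t z) \<longlongrightarrow> z) (at 0 within {0..})"
    by (simp add: continuous_within f0)
  then show "((\<lambda>t. flow t z) \<longlongrightarrow> z) (at_right 0)"
    by (rule tendsto_within_subset) auto
next
  fix s t :: real and z :: complex assume "0 \<le> s" "0 \<le> t" "z \<in> ball 0 1"
  then show "flow (s + t) z = flow s (flow t z)" by (intro flow_add)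
next
  have "q z \<noteq> 0" if "z \<in> ball 0 1" for z using pos [OF that] by auto
  then show "(\<lambda>z. - z / q z) holomorphic_on ball 0 1"
    using hol by (intro holomorphic_intros) auto
next
  fix z :: complex and t :: real assume "z \<in> ball 0 1" "0 \<le> t"
  then show "((\<lambda>s. flow s z) has_vector_derivative - flow t z / q (flow t z)) (at t within {0..})"
    by (rule flow_vector_derivative)
qed

end

text \<open>The constructive half of the Berkson-Porta formula with fixed point 0.\<close>

theorem Re_pos_generates:
  assumes "q holomorphic_on ball 0 1" "\<And>z. z \<in> ball 0 1 \<Longrightarrow> 0 < Re (q z)"
  obtains \<phi> where "generates (\<lambda>z. - z / q z) \<phi>" "\<And>t. \<phi> t 0 = 0"
proof -
  obtain Q where Q: "\<And>u. 0 < Re u \<Longrightarrow> (Q has_field_derivative q (exp (- u))) (at u)"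
    "\<And>u k. Q (u + of_real (2 * pi * of_int k) * \<i>) = Q u + of_real (2 * pi * of_int k) * \<i> * q 0"
    using half_plane_primitive [OF assms(1)] by metis
  interpret half_plane_model q Q
    unfolding half_plane_model_def using assms Q by blast
  show thesis using that generates_flow flow_0 by blast
qed

section \<open>Boundary fixed points and atoms\<close>

lemma right_derivative_nonneg:
  fixes f :: "real \<Rightarrow> real"
  assumes der: "(f has_real_derivative D) (at 0 within {0..})" and le: "\<And>s. 0 \<le> s \<Longrightarrow> f 0 \<le> f s"
  shows "0 \<le> D"
proof -
  have "((\<lambda>s. (f s - f 0) / (s - 0)) \<longlongrightarrow> D) (at 0 within {0..})"
    using der by (simp add: has_field_derivative_iff)
  moreover have "\<forall>\<^sub>F s in at 0 within {0..}. 0 \<le> (f s - f 0) / (s - 0)"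
    using le by (auto simp: eventually_at_filter)
  moreover have "at (0::real) within {0..} \<noteq> bot"
    by (simp add: at_within_Ici_at_right)
  ultimately show ?thesis by (rule tendsto_lowerbound)
qed

lemma has_real_derivative_Re:
  assumes "(f has_vector_derivative d) (at t within S)"
  shows "((\<lambda>s. Re (f s)) has_real_derivative Re d) (at t within S)"
  unfolding has_real_derivative_iff_has_vector_derivative
  using bounded_linear.has_vector_derivative [OF bounded_linear_Re assms] .

lemma semigroup_norm_le:
  assumes "is_semigroup \<phi>" "\<phi> t 0 = 0" "0 \<le> t" "z \<in> ball 0 1"
  shows "cmod (\<phi> t z) \<le> cmod z"
proof -
  have "\<phi> t holomorphic_on ball 0 1" "\<phi> t ` ball 0 1 \<subseteq> ball 0 1"
    using assms by (auto simp: is_semigroup_def unit_disk_def)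
  then show ?thesis
    using assms Schwarz_Lemma(1) [of "\<phi> t" z] by (auto simp: image_subset_iff)
qed

text \<open>By Schwarz's lemma \<open>|\<phi> s z|\<close> never exceeds its initial value, so the
  right derivative of \<open>- |\<phi> s z|^2\<close> at 0, which is
  \<open>2 |z|^2 Re (p z)\<close>, is nonnegative. At \<open>z = 0\<close> the sign of
  \<open>Re p\<close> follows by continuity.\<close>

lemma generator_fixing_0:
  assumes gen: "generates G \<phi>" and fix0: "\<And>t. 0 \<le> t \<Longrightarrow> \<phi> t 0 = 0"
  obtains p where "p holomorphic_on ball 0 1" "\<And>z. z \<in> ball 0 1 \<Longrightarrow> 0 \<le> Re (p z)"
    "\<And>z. z \<in> ball 0 1 \<Longrightarrow> G z = - z * p z"
proof -
  have sg: "is_semigroup \<phi>" and hol: "G holomorphic_on ball 0 1"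
    and start: "\<And>z. z \<in> ball 0 1 \<Longrightarrow> \<phi> 0 z = z"
    using gen by (auto simp: generates_def unit_disk_def is_semigroup_def)
  have der: "((\<lambda>s. \<phi> s z) has_vector_derivative G z) (at 0 within {0..})" if "z \<in> ball 0 1" for z
    using gen that start [OF that] unfolding generates_def unit_disk_def by (metis order_refl)
  have "((\<lambda>s. \<phi> s 0) has_vector_derivative 0) (at 0 within {0..})"
    by (rule has_vector_derivative_transform [where f = "\<lambda>_. 0"]) (auto simp: fix0)
  moreover have "at (0::real) within {0..} \<noteq> bot"
    by (simp add: at_within_Ici_at_right)
  ultimately have G0: "G 0 = 0"
    using der [of 0] vector_derivative_unique_within by fastforce
  define p where "p = (\<lambda>z. - (if z = 0 then deriv G 0 else (G z - G 0) / (z - 0)))"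
  have holp: "p holomorphic_on ball 0 1"
    unfolding p_def using hol by (intro holomorphic_on_minus pole_lemma) auto
  have Gp: "G z = - z * p z" for z
    by (simp add: p_def G0)
  have nn: "0 \<le> Re (p z)" if z: "z \<in> ball 0 1" "z \<noteq> 0" for z
  proof -
    have "((\<lambda>s. - ((Re (\<phi> s z))\<^sup>2 + (Im (\<phi> s z))\<^sup>2)) has_real_derivative
        - (2 * Re (G z) * Re (\<phi> 0 z) + 2 * Im (G z) * Im (\<phi> 0 z))) (at 0 within {0..})"
      using der [OF z(1)] by (auto intro!: derivative_eq_intros)
    then have "0 \<le> - (2 * Re (G z) * Re (\<phi> 0 z) + 2 * Im (G z) * Im (\<phi> 0 z))"
    proof (rule right_derivative_nonneg)
      fix s :: real assume "0 \<le> s"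
      then have "(cmod (\<phi> s z))\<^sup>2 \<le> (cmod (\<phi> 0 z))\<^sup>2"
        using semigroup_norm_le [OF sg fix0 _ z(1)] by (simp add: start [OF z(1)])
      then show "- ((Re (\<phi> 0 z))\<^sup>2 + (Im (\<phi> 0 z))\<^sup>2) \<le> - ((Re (\<phi> s z))\<^sup>2 + (Im (\<phi> s z))\<^sup>2)"
        unfolding cmod_power2 by simp
    qed
    then have "0 \<le> 2 * ((cmod z)\<^sup>2 * Re (p z))"
      unfolding start [OF z(1)] Gp cmod_power2 by (simp add: algebra_simps power2_eq_square)
    then show ?thesis using z by (simp add: zero_le_mult_iff)
  qed
  have "isCont p 0"
    using holomorphic_on_imp_continuous_on [OF holp] by (simp add: continuous_on_eq_continuous_at)
  then have "((\<lambda>z. Re (p z)) \<longlongrightarrow> Re (p 0)) (at 0)"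
    by (intro tendsto_Re) (simp add: isCont_def)
  moreover have "\<forall>\<^sub>F z in at 0. 0 \<le> Re (p z)"
    unfolding eventually_at using nn by (intro exI [of _ 1]) auto
  ultimately have "0 \<le> Re (p 0)" by (rule tendsto_lowerbound) simp
  then show thesis using that holp nn Gp by metis
qed

text \<open>On the radius \<open>|\<sigma> - z| = 1 - |z|\<close>, so it lies in every Stolz region
  with constant above 1; 2 is one choice. This turns angular limits into radial ones.\<close>

lemma filterlim_radial_stolz:
  assumes "cmod \<sigma> = 1"
  shows "filterlim (\<lambda>r. complex_of_real r * \<sigma>) (at \<sigma> within stolz \<sigma> 2) (at_left 1)"
  unfolding filterlim_at
proof
  have "((\<lambda>r. complex_of_real r * \<sigma>) \<longlongrightarrow> of_real 1 * \<sigma>) (at_left 1)"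
    by (intro tendsto_intros)
  then show "((\<lambda>r. complex_of_real r * \<sigma>) \<longlongrightarrow> \<sigma>) (at_left 1)" by simp
  have "complex_of_real r * \<sigma> \<in> stolz \<sigma> 2 \<and> complex_of_real r * \<sigma> \<noteq> \<sigma>" if r: "0 < r" "r < 1" for r
  proof -
    have "cmod (of_real r * \<sigma>) = r" using assms r by (simp add: norm_mult)
    moreover have "cmod (\<sigma> - of_real r * \<sigma>) = 1 - r"
    proof -
      have "\<sigma> - of_real r * \<sigma> = of_real (1 - r) * \<sigma>" by (simp add: algebra_simps)
      then show ?thesis using assms r by (simp add: norm_mult del: of_real_diff)
    qed
    ultimately show ?thesis using r assms by (auto simp: stolz_def)
  qed
  then show "\<forall>\<^sub>F r in at_left 1. complex_of_real r * \<sigma> \<in> stolz \<sigma> 2 \<and> complex_of_real r * \<sigma> \<noteq> \<sigma>"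
    unfolding eventually_at_left_field by (intro exI [of _ 0]) auto
qed

lemma angular_limit_radial:
  assumes "angular_limit f \<sigma> L" "cmod \<sigma> = 1"
  shows "((\<lambda>r. f (complex_of_real r * \<sigma>)) \<longlongrightarrow> L) (at_left 1)"
proof (rule filterlim_compose [OF _ filterlim_radial_stolz])
  show "(f \<longlongrightarrow> L) (at \<sigma> within stolz \<sigma> 2)"
    using assms(1) unfolding angular_limit_def by simp
qed fact

text \<open>Julia's lemma: \<open>julia_wolff\<close> applies to \<open>cayley \<sigma>\<close>
  composed with \<open>f\<close>, and the angular derivative \<open>d\<close> identifies its mass at
  \<open>\<sigma>\<close> as \<open>1 / d\<close>.\<close>

lemma julia_boundary_fixed_point:
  assumes hol: "f holomorphic_on ball 0 1" and self: "f ` ball 0 1 \<subseteq> ball 0 1"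
    and \<sigma>: "cmod \<sigma> = 1" and fixp: "angular_limit f \<sigma> \<sigma>"
    and ang: "angular_limit (\<lambda>z. (f z - \<sigma>) / (z - \<sigma>)) \<sigma> (complex_of_real d)"
    and d: "0 < d" and z: "z \<in> ball 0 1"
  shows "Re (cayley \<sigma> z) / d \<le> Re (cayley \<sigma> (f z))"
proof -
  have s0: "\<sigma> \<noteq> 0" using \<sigma> by auto
  have "\<sigma> \<notin> f ` ball 0 1" using self \<sigma> by auto
  then have holk: "(cayley \<sigma> \<circ> f) holomorphic_on ball 0 1"
    using hol by (intro holomorphic_on_compose cayley_holomorphic)
  have knn: "0 \<le> Re ((cayley \<sigma> \<circ> f) w)" if "w \<in> ball 0 1" for w
  proof -
    have "f w \<in> ball 0 1" using self that by blast
    from Re_cayley_pos [OF \<sigma> this] show ?thesis by simp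
  qed
  obtain c where c: "((\<lambda>r. (cayley \<sigma> \<circ> f) (complex_of_real r * \<sigma>) * complex_of_real (1 - r)) \<longlongrightarrow> complex_of_real (2 * c)) (at_left 1)"
    "\<And>z. z \<in> ball 0 1 \<Longrightarrow> c * Re (cayley \<sigma> z) \<le> Re ((cayley \<sigma> \<circ> f) z)"
    using julia_wolff [OF holk knn \<sigma>] by metis
  \<comment> \<open>Since \<open>\<sigma> - r \<sigma> = (1 - r) \<sigma>\<close>, the weighted
    Cayley transform can be written through the difference quotient of \<open>f\<close>, whose limit
    is known.\<close>
  have "((\<lambda>r. (\<sigma> + f (complex_of_real r * \<sigma>)) /
        ((f (complex_of_real r * \<sigma>) - \<sigma>) / (complex_of_real r * \<sigma> - \<sigma>) * \<sigma>))
      \<longlongrightarrow> (\<sigma> + \<sigma>) / (complex_of_real d * \<sigma>)) (at_left 1)"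
    using d s0 by (intro tendsto_intros angular_limit_radial [OF fixp \<sigma>] angular_limit_radial [OF ang \<sigma>]) auto
  moreover have "\<forall>\<^sub>F r in at_left 1. (\<sigma> + f (complex_of_real r * \<sigma>)) /
        ((f (complex_of_real r * \<sigma>) - \<sigma>) / (complex_of_real r * \<sigma> - \<sigma>) * \<sigma>)
      = (cayley \<sigma> \<circ> f) (complex_of_real r * \<sigma>) * complex_of_real (1 - r)"
    unfolding eventually_at_left_field
  proof (intro exI [of _ 0] conjI allI impI)
    fix r :: real assume r: "0 < r" "r < 1"
    let ?w = "complex_of_real r * \<sigma>"
    have "?w \<in> ball 0 1" using r \<sigma> by (simp add: norm_mult)
    then have "f ?w \<in> ball 0 1" using self by blast
    then have ne: "f ?w \<noteq> \<sigma>" using \<sigma> by auto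
    have w: "?w - \<sigma> = - (of_real (1 - r) * \<sigma>)" by (simp add: algebra_simps)
    show "(\<sigma> + f ?w) / ((f ?w - \<sigma>) / (?w - \<sigma>) * \<sigma>) = (cayley \<sigma> \<circ> f) ?w * complex_of_real (1 - r)"
      unfolding w comp_def cayley_def using ne s0 r by (simp add: divide_simps del: of_real_diff) (simp add: algebra_simps)
  qed auto
  ultimately have "((\<lambda>r. (cayley \<sigma> \<circ> f) (complex_of_real r * \<sigma>) * complex_of_real (1 - r)) \<longlongrightarrow>
      (\<sigma> + \<sigma>) / (complex_of_real d * \<sigma>)) (at_left 1)"
    by (rule Lim_transform_eventually)
  then have "complex_of_real (2 * c) = (\<sigma> + \<sigma>) / (complex_of_real d * \<sigma>)"
    using tendsto_unique [OF _ c(1)] by (simp add: trivial_limit_at_left_real)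
  also have "\<dots> = complex_of_real (2 / d)"
    using s0 by (simp add: divide_simps)
  finally have "c = 1 / d" by (simp only: of_real_eq_iff)
  then show ?thesis using c(2) [OF z] by simp
qed

lemma cayley_deriv:
  assumes "z \<noteq> \<sigma>"
  shows "(cayley \<sigma> has_field_derivative 2 * \<sigma> / (\<sigma> - z)\<^sup>2) (at z within S)"
proof -
  have "((\<lambda>z. (\<sigma> + z) / (\<sigma> - z)) has_field_derivative
      ((0 + 1) * (\<sigma> - z) - (\<sigma> + z) * (0 - 1)) / ((\<sigma> - z) * (\<sigma> - z))) (at z within S)"
    using assms by (intro DERIV_divide DERIV_add DERIV_diff DERIV_const DERIV_ident) auto
  then show ?thesis by (simp add: cayley_def [abs_def] power2_eq_square)
qed

text \<open>Julia's inequality for \<open>\<phi> s\<close>, with \<open>d = exp (- \<mu> s)\<close>,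
  is an equality at \<open>s = 0\<close>; differentiating it there from the right gives an
  inequality for \<open>G\<close>.\<close>

lemma BRFP_generator_inequality:
  assumes gen: "generates G \<phi>" and brfp: "is_BRFP \<phi> \<sigma> \<mu>" and z: "z \<in> ball 0 1"
  shows "0 \<le> Re (of_real (- \<mu>) * cayley \<sigma> z + 2 * \<sigma> / (\<sigma> - z)\<^sup>2 * G z)"
proof -
  have \<sigma>: "cmod \<sigma> = 1" using brfp by (simp add: is_BRFP_def)
  have start: "\<phi> 0 z = z"
    using gen z by (simp add: generates_def unit_disk_def is_semigroup_def)
  have der: "((\<lambda>s. \<phi> s z) has_vector_derivative G (\<phi> 0 z)) (at 0 within {0..})"
    using gen z unfolding generates_def unit_disk_def by (metis order_refl)
  have "z \<noteq> \<sigma>" using z \<sigma> by auto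
  then have "((cayley \<sigma> \<circ> (\<lambda>s. \<phi> s z)) has_vector_derivative G z * (2 * \<sigma> / (\<sigma> - z)\<^sup>2)) (at 0 within {0..})"
    using field_vector_diff_chain_within [OF der cayley_deriv] by (simp add: start)
  then have "((\<lambda>s. Re (cayley \<sigma> (\<phi> s z))) has_real_derivative Re (G z * (2 * \<sigma> / (\<sigma> - z)\<^sup>2))) (at 0 within {0..})"
    unfolding comp_def by (rule has_real_derivative_Re)
  then have "((\<lambda>s. Re (cayley \<sigma> (\<phi> s z)) - exp (\<mu> * s) * Re (cayley \<sigma> z)) has_real_derivative
      Re (G z * (2 * \<sigma> / (\<sigma> - z)\<^sup>2)) - \<mu> * Re (cayley \<sigma> z)) (at 0 within {0..})"
    by (rule DERIV_diff) (auto intro!: derivative_eq_intros)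
  then have "0 \<le> Re (G z * (2 * \<sigma> / (\<sigma> - z)\<^sup>2)) - \<mu> * Re (cayley \<sigma> z)"
  proof (rule right_derivative_nonneg)
    fix s :: real assume s: "0 \<le> s"
    have "Re (cayley \<sigma> z) / exp (- \<mu> * s) \<le> Re (cayley \<sigma> (\<phi> s z))"
      using gen brfp s z
      by (intro julia_boundary_fixed_point) (auto simp: generates_def is_semigroup_def unit_disk_def is_BRFP_def)
    then show "Re (cayley \<sigma> (\<phi> 0 z)) - exp (\<mu> * 0) * Re (cayley \<sigma> z)
        \<le> Re (cayley \<sigma> (\<phi> s z)) - exp (\<mu> * s) * Re (cayley \<sigma> z)"
      by (simp add: start exp_minus field_simps)
  qed
  moreover have "Re (of_real (- \<mu>) * cayley \<sigma> z) = - \<mu> * Re (cayley \<sigma> z)" by simp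
  ultimately show ?thesis by (simp add: mult.commute del: of_real_minus)
qed


text \<open>The function with nonnegative real part in \<open>BRFP_generator_inequality\<close> yields a real limit
  \<open>l \<le> \<bar>\<mu>\<bar>\<close> of \<open>p / (1 - r)\<close> along the radius; unless \<open>p = 0\<close>, the finite radial limit for
  \<open>1 / p\<close> forces \<open>l > 0\<close>.\<close>

lemma BRFP_mass:
  assumes gen: "generates G \<phi>" and brfp: "is_BRFP \<phi> \<sigma> \<mu>"
    and holp: "p holomorphic_on ball 0 1" and pnn: "\<And>z. z \<in> ball 0 1 \<Longrightarrow> 0 \<le> Re (p z)"
    and Gp: "\<And>z. z \<in> ball 0 1 \<Longrightarrow> G z = - z * p z"
  shows "(\<forall>z\<in>ball 0 1. p z = 0) \<or> (\<forall>z\<in>ball 0 1. 0 < Re (p z)) \<and> \<mu> < 0 \<and>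
    (\<exists>c \<ge> 1 / (2 * \<bar>\<mu>\<bar>).
      ((\<lambda>r. 1 / p (complex_of_real r * \<sigma>) * complex_of_real (1 - r)) \<longlongrightarrow> complex_of_real (2 * c)) (at_left 1))"
proof -
  have \<sigma>: "cmod \<sigma> = 1" using brfp by (simp add: is_BRFP_def)
  then have s0: "\<sigma> \<noteq> 0" by auto
  define H where "H = (\<lambda>z. of_real (- \<mu>) * cayley \<sigma> z + 2 * \<sigma> / (\<sigma> - z)\<^sup>2 * G z)"
  have "\<sigma> \<notin> ball 0 1" using \<sigma> by simp
  moreover have "G holomorphic_on ball 0 1" using gen by (simp add: generates_def unit_disk_def)
  ultimately have holH: "H holomorphic_on ball 0 1"
    unfolding H_def by (intro holomorphic_intros) auto
  have Hnn: "0 \<le> Re (H z)" if "z \<in> ball 0 1" for z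
    unfolding H_def using BRFP_generator_inequality [OF gen brfp that] .
  obtain d where d: "0 \<le> d"
    "((\<lambda>r. H (complex_of_real r * \<sigma>) * complex_of_real (1 - r)) \<longlongrightarrow> complex_of_real (2 * d)) (at_left 1)"
    using julia_wolff [OF holH Hnn \<sigma>] by metis
  have ev: "\<forall>\<^sub>F r in at_left 1. 0 < r \<and> r < (1::real)"
    by (intro eventually_conj) (auto simp: eventually_at_left_field intro: exI [of _ 0])
  have ball: "complex_of_real r * \<sigma> \<in> ball 0 1" if "0 < r" "r < 1" for r
    using that \<sigma> by (simp add: norm_mult)
  \<comment> \<open>The definition of \<open>H\<close> solved for \<open>p\<close> at
    \<open>z = r \<sigma>\<close>: with \<open>G z = - z * p z\<close> the last term of
    \<open>H\<close>, times \<open>1 - r\<close>, is \<open>- 2 r p / (1 - r)\<close>.\<close>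
  have lim: "((\<lambda>r. (of_real (- \<mu>) * (cayley \<sigma> (complex_of_real r * \<sigma>) * complex_of_real (1 - r))
        - H (complex_of_real r * \<sigma>) * complex_of_real (1 - r)) / (2 * of_real r))
      \<longlongrightarrow> (of_real (- \<mu>) * (if \<sigma> = \<sigma> then 2 else 0) - complex_of_real (2 * d)) / (2 * of_real 1)) (at_left 1)"
    by (intro tendsto_intros d tendsto_cayley_radial \<sigma>) auto
  have val: "(of_real (- \<mu>) * (if \<sigma> = \<sigma> then 2 else 0) - complex_of_real (2 * d)) / (2 * of_real 1)
      = complex_of_real (- \<mu> - d)"
    by (simp add: field_simps)
  have "\<forall>\<^sub>F r in at_left 1. (of_real (- \<mu>) * (cayley \<sigma> (complex_of_real r * \<sigma>) * complex_of_real (1 - r))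
        - H (complex_of_real r * \<sigma>) * complex_of_real (1 - r)) / (2 * of_real r)
      = p (complex_of_real r * \<sigma>) / complex_of_real (1 - r)"
    using ev
  proof eventually_elim
    case (elim r)
    let ?w = "complex_of_real r * \<sigma>"
    have w: "\<sigma> - ?w = of_real (1 - r) * \<sigma>" by (simp add: algebra_simps)
    have "of_real (- \<mu>) * (cayley \<sigma> ?w * complex_of_real (1 - r)) - H ?w * complex_of_real (1 - r)
        = - (2 * \<sigma> / (\<sigma> - ?w)\<^sup>2 * G ?w) * complex_of_real (1 - r)"
      by (simp add: H_def algebra_simps)
    also have "\<dots> = 2 * of_real r * (p ?w / complex_of_real (1 - r))"
      unfolding w using elim s0 Gp ball [of r]
      by (simp add: power2_eq_square divide_simps del: of_real_diff)
    finally show ?case using elim by simp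
  qed
  then have lim_p: "((\<lambda>r. p (complex_of_real r * \<sigma>) / complex_of_real (1 - r)) \<longlongrightarrow> complex_of_real (- \<mu> - d)) (at_left 1)"
    by (rule Lim_transform_eventually [OF lim [unfolded val]])
  have lim_1r: "((\<lambda>r. complex_of_real (1 - r)) \<longlongrightarrow> of_real (1 - 1)) (at_left 1)"
    by (intro tendsto_intros)
  consider (const) b where "\<And>z. z \<in> ball 0 1 \<Longrightarrow> p z = \<i> * complex_of_real b"
    | (pos) "\<And>z. z \<in> ball 0 1 \<Longrightarrow> 0 < Re (p z)"
    using nonneg_Re_dichotomy holp pnn by blast
  then show ?thesis
  proof cases
    case const
    \<comment> \<open>A constant whose quotient by \<open>1 - r\<close> stays bounded must be 0;
      this excludes rotations.\<close>
    have "((\<lambda>r. p (complex_of_real r * \<sigma>) / complex_of_real (1 - r) * complex_of_real (1 - r))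
        \<longlongrightarrow> complex_of_real (- \<mu> - d) * of_real (1 - 1)) (at_left 1)"
      by (intro tendsto_mult lim_p lim_1r)
    moreover have "\<forall>\<^sub>F r in at_left 1. p (complex_of_real r * \<sigma>) / complex_of_real (1 - r) * complex_of_real (1 - r)
       = \<i> * complex_of_real b"
      using ev by eventually_elim (use const ball in auto)
    ultimately have "((\<lambda>r::real. \<i> * complex_of_real b) \<longlongrightarrow> complex_of_real (- \<mu> - d) * of_real (1 - 1)) (at_left 1)"
      by (rule Lim_transform_eventually)
    then have "\<i> * complex_of_real b = 0"
      by (simp add: tendsto_const_iff trivial_limit_at_left_real)
    then show ?thesis using const by auto
  next
    case pos
    have ne: "p z \<noteq> 0" if "z \<in> ball 0 1" for z using pos [OF that] by auto
    have holq: "(\<lambda>z. 1 / p z) holomorphic_on ball 0 1"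
      using holp ne by (intro holomorphic_intros) auto
    have qnn: "0 \<le> Re (1 / p z)" if "z \<in> ball 0 1" for z
      using pos [OF that] by (simp add: Re_complex_div_ge_0)
    obtain c where c: "0 \<le> c"
      "((\<lambda>r. 1 / p (complex_of_real r * \<sigma>) * complex_of_real (1 - r)) \<longlongrightarrow> complex_of_real (2 * c)) (at_left 1)"
      using julia_wolff [OF holq qnn \<sigma>] by metis
    \<comment> \<open>The two quotients are reciprocal, so their limits satisfy
      \<open>(- \<mu> - d) * (2 * c) = 1\<close>; dropping \<open>d \<ge> 0\<close> bounds
      \<open>c\<close> below by \<open>1 / (2 |\<mu>|)\<close>.\<close>
    have "((\<lambda>r. p (complex_of_real r * \<sigma>) / complex_of_real (1 - r) *
          (1 / p (complex_of_real r * \<sigma>) * complex_of_real (1 - r)))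
        \<longlongrightarrow> complex_of_real (- \<mu> - d) * complex_of_real (2 * c)) (at_left 1)"
      by (intro tendsto_mult lim_p c)
    moreover have "\<forall>\<^sub>F r in at_left 1. p (complex_of_real r * \<sigma>) / complex_of_real (1 - r) *
          (1 / p (complex_of_real r * \<sigma>) * complex_of_real (1 - r)) = 1"
      using ev by eventually_elim (use ne ball in auto)
    ultimately have "((\<lambda>r::real. 1) \<longlongrightarrow> complex_of_real (- \<mu> - d) * complex_of_real (2 * c)) (at_left 1)"
      by (rule Lim_transform_eventually)
    then have "complex_of_real ((- \<mu> - d) * (2 * c)) = complex_of_real 1"
      by (simp add: tendsto_const_iff trivial_limit_at_left_real)
    then have eq: "(- \<mu> - d) * (2 * c) = 1" by (simp only: of_real_eq_iff)
    then have "0 < c" using c(1) by (cases "c = 0") auto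
    then have "0 < - \<mu> - d" using eq by (metis mult_pos_pos zero_less_mult_pos2 zero_less_numeral zero_less_one)
    then have "\<mu> < 0" using d by simp
    have "1 \<le> - \<mu> * (2 * c)"
      using eq mult_right_mono [of "- \<mu> - d" "- \<mu>" "2 * c"] d \<open>0 < c\<close> by simp
    then have "1 / (2 * \<bar>\<mu>\<bar>) \<le> c" using \<open>\<mu> < 0\<close> by (simp add: field_simps)
    then show ?thesis using pos \<open>\<mu> < 0\<close> c(2) by blast
  qed
qed

section \<open>Herglotz form of the class and its derivatives at the origin\<close>

lemma p0_cayley: "p0 n \<sigma> lam z = (\<Sum>k\<in>{1..n}. complex_of_real (1 / (2 * \<bar>lam k\<bar>)) * cayley (\<sigma> k) z)"
  by (simp add: p0_def cayley_def)

text \<open>Each node carries mass at least \<open>1 / (2 |\<mu>|)\<close>, and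
  \<open>lam k \<le> \<mu> < 0\<close> makes this at least the weight in \<open>p0\<close>.
  \<open>julia_wolff_sum\<close> subtracts all the masses at once.\<close>

lemma Gen0_FL_imp_herglotz:
  assumes n: "n \<ge> 1" and inj: "inj_on \<sigma> {1..n}" and neg: "\<forall>k\<in>{1..n}. lam k < 0"
    and G: "G \<in> Gen0_FL n \<sigma> lam"
  shows "(\<forall>z\<in>ball 0 1. G z = 0) \<or> (\<exists>q. q holomorphic_on ball 0 1 \<and>
    (\<forall>z\<in>ball 0 1. 0 < Re (q z) \<and> G z = - z / q z \<and> 0 \<le> Re (q z - p0 n \<sigma> lam z)))"
proof -
  obtain \<phi> where gen: "generates G \<phi>" and fix0: "\<And>t. 0 \<le> t \<Longrightarrow> \<phi> t 0 = 0"
    and ex: "\<And>k. k \<in> {1..n} \<Longrightarrow> \<exists>\<mu>. is_BRFP \<phi> (\<sigma> k) \<mu> \<and> lam k \<le> \<mu> \<and> \<mu> \<le> 0"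
    using G by (auto simp: Gen0_FL_def)
  obtain p where p: "p holomorphic_on ball 0 1" "\<And>z. z \<in> ball 0 1 \<Longrightarrow> 0 \<le> Re (p z)"
    "\<And>z. z \<in> ball 0 1 \<Longrightarrow> G z = - z * p z"
    using generator_fixing_0 [OF gen fix0] by metis
  show ?thesis
  proof (cases "\<forall>z\<in>ball 0 1. p z = 0")
    case True
    then show ?thesis using p by simp
  next
    case False
    have mass: "(\<forall>z\<in>ball 0 1. 0 < Re (p z)) \<and> (\<exists>c \<ge> 1 / (2 * \<bar>lam k\<bar>).
      ((\<lambda>r. 1 / p (complex_of_real r * \<sigma> k) * complex_of_real (1 - r)) \<longlongrightarrow> complex_of_real (2 * c)) (at_left 1))"
      if k: "k \<in> {1..n}" for k
    proof -
      obtain \<mu> where \<mu>: "is_BRFP \<phi> (\<sigma> k) \<mu>" "lam k \<le> \<mu>" using ex [OF k] by blast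
      from BRFP_mass [OF gen \<mu>(1) p] False
      obtain c where c: "\<forall>z\<in>ball 0 1. 0 < Re (p z)" "\<mu> < 0" "1 / (2 * \<bar>\<mu>\<bar>) \<le> c"
        "((\<lambda>r. 1 / p (complex_of_real r * \<sigma> k) * complex_of_real (1 - r)) \<longlongrightarrow> complex_of_real (2 * c)) (at_left 1)"
        by blast
      have "1 / (2 * \<bar>lam k\<bar>) \<le> 1 / (2 * \<bar>\<mu>\<bar>)"
        using \<mu>(2) c(2) by (intro divide_left_mono) (auto intro: mult_neg_neg)
      then show ?thesis using c by (meson order_trans)
    qed
    \<comment> \<open>\<open>n \<ge> 1\<close> supplies a node, and with it the strict positivity
      from \<open>BRFP_mass\<close>.\<close>
    then have pos: "0 < Re (p z)" if "z \<in> ball 0 1" for z using n that by force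
    obtain c where c: "\<And>k. k \<in> {1..n} \<Longrightarrow> 1 / (2 * \<bar>lam k\<bar>) \<le> c k"
      "\<And>k. k \<in> {1..n} \<Longrightarrow> ((\<lambda>r. 1 / p (complex_of_real r * \<sigma> k) * complex_of_real (1 - r)) \<longlongrightarrow> complex_of_real (2 * c k)) (at_left 1)"
    proof -
      have "\<exists>c. \<forall>k\<in>{1..n}. 1 / (2 * \<bar>lam k\<bar>) \<le> c k \<and>
        ((\<lambda>r. 1 / p (complex_of_real r * \<sigma> k) * complex_of_real (1 - r)) \<longlongrightarrow> complex_of_real (2 * c k)) (at_left 1)"
        by (rule bchoice) (use mass in blast)
      then show thesis using that by blast
    qed
    have \<sigma>: "cmod (\<sigma> k) = 1" if "k \<in> {1..n}" for k
      using ex [OF that] by (auto simp: is_BRFP_def)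
    define q where "q = (\<lambda>z. 1 / p z)"
    have ne: "p z \<noteq> 0" if "z \<in> ball 0 1" for z using pos [OF that] by auto
    have holq: "q holomorphic_on ball 0 1"
      unfolding q_def using p(1) ne by (intro holomorphic_intros) auto
    have qpos: "0 < Re (q z)" if "z \<in> ball 0 1" for z
      using pos [OF that] by (simp add: q_def Re_complex_div_gt_0)
    have "0 \<le> Re (q z - p0 n \<sigma> lam z)" if z: "z \<in> ball 0 1" for z
    proof -
      have "Re (p0 n \<sigma> lam z) = (\<Sum>k\<in>{1..n}. 1 / (2 * \<bar>lam k\<bar>) * Re (cayley (\<sigma> k) z))"
        unfolding p0_cayley Re_sum by (intro sum.cong refl) (simp del: of_real_divide)
      also have "\<dots> \<le> (\<Sum>k\<in>{1..n}. c k * Re (cayley (\<sigma> k) z))"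
        using c(1) Re_cayley_pos [OF \<sigma> z] by (intro sum_mono mult_right_mono) (auto intro: less_imp_le)
      also have "\<dots> \<le> Re (q z)"
        using holq qpos inj \<sigma> c(2) z unfolding q_def
        by (intro julia_wolff_sum) (auto intro: less_imp_le)
      finally show ?thesis by simp
    qed
    then show ?thesis using holq qpos p(3) by (intro disjI2 exI [of _ q]) (auto simp: q_def)
  qed
qed

text \<open>Read off from the expansion
  \<open>- z / q z = - z / q 0 + (deriv q 0 / (q 0)^2) z^2 + ...\<close>. As \<open>G\<close> is
  known on the disk alone, derivatives pass over by equality near each point.\<close>

lemma Vpt_quotient:
  assumes hol: "q holomorphic_on ball 0 1" and ne: "\<And>z. z \<in> ball 0 1 \<Longrightarrow> q z \<noteq> 0"
    and G: "\<And>z. z \<in> ball 0 1 \<Longrightarrow> G z = - z / q z"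
  shows "Vpt G = (2 * deriv q 0 / (q 0)\<^sup>2, 1 / q 0)"
proof -
  have dq: "(q has_field_derivative deriv q z) (at z)" if "z \<in> ball 0 1" for z
    using hol that by (intro holomorphic_derivI) auto
  have "(deriv q) holomorphic_on ball 0 1"
    using hol by (intro holomorphic_deriv) auto
  then have ddq: "(deriv q has_field_derivative deriv (deriv q) 0) (at 0)"
    by (rule holomorphic_derivI) auto
  have ev: "\<forall>\<^sub>F z in nhds w. z \<in> ball 0 1" if "w \<in> ball 0 1" for w :: complex
    using that by (intro eventually_nhds_in_open) auto
  have dG: "deriv G z = - (1 / q z) + z * deriv q z / (q z)\<^sup>2" if z: "z \<in> ball 0 1" for z
  proof -
    have "((\<lambda>z. - z / q z) has_field_derivative - (1 / q z) + z * deriv q z / (q z)\<^sup>2) (at z)"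
      using dq [OF z] ne [OF z] by (auto intro!: derivative_eq_intros simp: power2_eq_square field_simps)
    moreover have "\<forall>\<^sub>F w in nhds z. G w = - w / q w"
      using ev [OF z] by eventually_elim (rule G)
    ultimately show ?thesis by (metis DERIV_imp_deriv deriv_cong_ev)
  qed
  have "((\<lambda>z. - (1 / q z) + z * deriv q z / (q z)\<^sup>2) has_field_derivative 2 * deriv q 0 / (q 0)\<^sup>2) (at 0)"
    using dq [of 0] ddq ne [of 0] by (auto intro!: derivative_eq_intros simp: power2_eq_square field_simps)
  then have "deriv (\<lambda>z. - (1 / q z) + z * deriv q z / (q z)\<^sup>2) 0 = 2 * deriv q 0 / (q 0)\<^sup>2"
    by (rule DERIV_imp_deriv)
  moreover have "\<forall>\<^sub>F z in nhds (0::complex). z \<in> ball 0 1"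
    by (rule ev) simp
  then have "\<forall>\<^sub>F z in nhds 0. deriv G z = - (1 / q z) + z * deriv q z / (q z)\<^sup>2"
    by eventually_elim (rule dG)
  then have "deriv (deriv G) 0 = deriv (\<lambda>z. - (1 / q z) + z * deriv q z / (q z)\<^sup>2) 0"
    by (rule deriv_cong_ev) simp
  ultimately have "deriv (deriv G) 0 = 2 * deriv q 0 / (q 0)\<^sup>2"
    by simp
  then show ?thesis using dG [of 0] by (simp add: Vpt_def)
qed

section \<open>Boundary fixed points of an explicit flow\<close>

text \<open>A Gronwall estimate for \<open>x' = m x + error\<close>. The factor
  \<open>exp (- m s)\<close> removes the linear part; the rest \<open>y\<close> grows at most like
  \<open>exp (\<epsilon> s)\<close>. Since \<open>close\<close> holds only while
  \<open>|x| < \<delta>\<close>, a first-exit argument is required before the mean value inequality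
  gives the claim.\<close>

lemma linear_perturbation_bounds:
  fixes x x' :: "real \<Rightarrow> complex"
  assumes der: "\<And>s. 0 \<le> s \<Longrightarrow> (x has_vector_derivative x' s) (at s within {0..})"
    and close: "\<And>s. 0 \<le> s \<Longrightarrow> cmod (x s) < \<delta> \<Longrightarrow> cmod (x' s - of_real m * x s) \<le> \<epsilon> * cmod (x s)"
    and \<epsilon>: "0 \<le> \<epsilon>" and t: "0 \<le> t" and small: "exp ((\<bar>m\<bar> + \<epsilon>) * t) * cmod (x 0) < \<delta>"
  shows "cmod (x t * exp (of_real (- m * t)) - x 0) \<le> t * \<epsilon> * exp (\<epsilon> * t) * cmod (x 0)"
proof -
  define y where "y = (\<lambda>s. x s * exp (of_real (- m * s)))"
  define r where "r = (\<lambda>s. (x' s - of_real m * x s) * exp (of_real (- m * s)))"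
  have norm_y: "cmod (y s) = cmod (x s) * exp (- m * s)" for s
    by (simp add: y_def norm_mult)
  have dy: "(y has_vector_derivative r s) (at s within {0..})" if "0 \<le> s" for s
  proof -
    have "((\<lambda>w. exp (- (of_real m * w))) has_field_derivative exp (- (of_real m * of_real s)) * - of_real m) (at (complex_of_real s))"
      by (auto intro!: derivative_eq_intros)
    then have "((\<lambda>s. exp (- (of_real m * complex_of_real s))) has_vector_derivative
        exp (- (of_real m * of_real s)) * - of_real m) (at s within {0..})"
      by (rule has_vector_derivative_real_field [THEN has_vector_derivative_at_within])
    from has_vector_derivative_mult [OF der [OF that] this]
    show ?thesis by (simp add: y_def r_def algebra_simps)
  qed
  have r_le: "cmod (r s) \<le> \<epsilon> * cmod (y s)" if "0 \<le> s" "cmod (x s) < \<delta>" for s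
    using mult_right_mono [OF close [OF that], of "exp (- m * s)"]
    by (simp add: norm_y r_def norm_mult mult.assoc)
  have dy_at: "(y has_vector_derivative r s) (at s)" if "0 < s" for s
  proof -
    have "at s within {0..} = at s"
      by (rule at_within_interior) (use that in \<open>simp add: interior_Ici\<close>)
    then show ?thesis using dy [of s] that by simp
  qed
  have cont_y: "continuous_on {0..} y"
    using dy has_vector_derivative_continuous by (metis continuous_on_eq_continuous_within atLeast_iff)
  have growth: "cmod (y b) \<le> exp (\<epsilon> * b) * cmod (x 0)"
    if b: "0 \<le> b" and lt: "\<And>s. 0 < s \<Longrightarrow> s < b \<Longrightarrow> cmod (x s) < \<delta>" for b
  proof -
    \<comment> \<open>The squared modulus is differentiable even where \<open>y\<close> vanishes;
      the factor with \<open>2 * \<epsilon>\<close> makes it nonincreasing.\<close>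
    define v where "v = (\<lambda>s. ((Re (y s))\<^sup>2 + (Im (y s))\<^sup>2) * exp (- 2 * \<epsilon> * s))"
    have "v b \<le> v 0"
    proof (rule DERIV_nonpos_imp_decreasing_open [OF b])
      fix s assume s: "0 < s" "s < b"
      have "(v has_real_derivative (2 * (Re (y s) * Re (r s) + Im (y s) * Im (r s))
          - 2 * \<epsilon> * (cmod (y s))\<^sup>2) * exp (- 2 * \<epsilon> * s)) (at s)"
        unfolding v_def cmod_power2 using dy_at [OF s(1)]
        by (auto intro!: derivative_eq_intros simp: algebra_simps)
      moreover have "Re (y s) * Re (r s) + Im (y s) * Im (r s) \<le> \<epsilon> * (cmod (y s))\<^sup>2"
      proof -
        have "Re (y s) * Re (r s) + Im (y s) * Im (r s) = Re (cnj (y s) * r s)" by simp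
        also have "\<dots> \<le> cmod (y s) * cmod (r s)"
          by (metis complex_Re_le_cmod norm_mult complex_mod_cnj)
        also have "\<dots> \<le> cmod (y s) * (\<epsilon> * cmod (y s))"
          using r_le lt s by (intro mult_left_mono) auto
        finally show ?thesis by (simp add: power2_eq_square mult_ac)
      qed
      then have "(2 * (Re (y s) * Re (r s) + Im (y s) * Im (r s)) - 2 * \<epsilon> * (cmod (y s))\<^sup>2) * exp (- 2 * \<epsilon> * s) \<le> 0"
        by (intro mult_nonpos_nonneg) auto
      ultimately show "\<exists>l. (v has_real_derivative l) (at s) \<and> l \<le> 0" by blast
    next
      show "continuous_on {0..b} v"
        unfolding v_def by (intro continuous_intros continuous_on_subset [OF cont_y]) auto
    qed
    then have "(cmod (y b))\<^sup>2 * exp (- 2 * \<epsilon> * b) \<le> (cmod (x 0))\<^sup>2"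
      unfolding v_def cmod_power2 by (simp add: y_def)
    then have "(cmod (y b))\<^sup>2 \<le> exp (2 * \<epsilon> * b) * (cmod (x 0))\<^sup>2"
      by (simp add: exp_minus field_simps)
    also have "\<dots> = (exp (\<epsilon> * b) * cmod (x 0))\<^sup>2"
      by (simp add: power_mult_distrib exp_double [symmetric] mult.assoc)
    finally show ?thesis by (rule power2_le_imp_le) simp
  qed
  have bound: "cmod (x s) < \<delta>" if s: "0 \<le> s" "s \<le> t" for s
  proof (rule ccontr)
    assume neg: "\<not> ?thesis"
    \<comment> \<open>\<open>Inf B\<close> is the first exit time. The growth bound holds up to it
      and, by \<open>small\<close>, keeps \<open>|x|\<close> below \<open>\<delta>\<close> there.
      Using \<open>|m|\<close> makes the bound monotone in time.\<close>
    define B where "B = {s \<in> {0..t}. \<delta> \<le> cmod (x s)}"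
    have cont_x: "continuous_on {0..} x"
      using der has_vector_derivative_continuous by (metis continuous_on_eq_continuous_within atLeast_iff)
    then have "continuous_on {0..t} (\<lambda>s. cmod (x s))"
      by (intro continuous_intros) (auto intro: continuous_on_subset)
    then have "closed B" unfolding B_def 
      by (rule continuous_on_closed_Collect_le [OF continuous_on_const _ closed_atLeastAtMost])
    moreover have "B \<noteq> {}" using neg s by (auto simp: B_def)
    moreover have bdd: "bdd_below B" by (auto simp: B_def intro!: bdd_belowI [of _ 0])
    ultimately have "Inf B \<in> B" by (intro closed_contains_Inf)
    then have b: "0 \<le> Inf B" "Inf B \<le> t" "\<delta> \<le> cmod (x (Inf B))" by (auto simp: B_def)
    have "cmod (x s) < \<delta>" if "0 < s" "s < Inf B" for s
      using cInf_lower [OF _ bdd, of s] that b by (force simp: B_def)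
    then have "cmod (y (Inf B)) \<le> exp (\<epsilon> * Inf B) * cmod (x 0)" using growth b by blast
    then have "cmod (x (Inf B)) \<le> exp (m * Inf B) * (exp (\<epsilon> * Inf B) * cmod (x 0))"
      by (simp add: norm_y exp_minus field_simps)
    also have "\<dots> = exp ((m + \<epsilon>) * Inf B) * cmod (x 0)"
      by (simp add: exp_add [symmetric] algebra_simps)
    also have "\<dots> \<le> exp ((\<bar>m\<bar> + \<epsilon>) * t) * cmod (x 0)"
    proof -
      have "(m + \<epsilon>) * Inf B \<le> (\<bar>m\<bar> + \<epsilon>) * Inf B" using b by (intro mult_right_mono) auto
      also have "\<dots> \<le> (\<bar>m\<bar> + \<epsilon>) * t" using b \<epsilon> by (intro mult_left_mono) auto
      finally show ?thesis by (intro mult_right_mono) auto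
    qed
    finally show False using small b by simp
  qed
  show ?thesis
  proof (cases "t = 0")
    case False
    then have "0 < t" using t by simp
    then obtain s where s: "s \<in> {0<..<t}" "norm (y t - y 0) \<le> norm ((t - 0) *\<^sub>R r s)"
      using mvt_general [of 0 t y "\<lambda>s h. h *\<^sub>R r s"] dy_at continuous_on_subset [OF cont_y, of "{0..t}"]
      by (force simp: has_vector_derivative_def)
    have "cmod (y t - y 0) \<le> t * cmod (r s)" using s t by simp
    also have "\<dots> \<le> t * (\<epsilon> * cmod (y s))"
      using r_le [of s] bound [of s] s t by (intro mult_left_mono) auto
    also have "\<dots> \<le> t * (\<epsilon> * (exp (\<epsilon> * s) * cmod (x 0)))"
      using growth [of s] bound s t \<epsilon> by (intro mult_left_mono) auto
    also have "\<dots> \<le> t * (\<epsilon> * (exp (\<epsilon> * t) * cmod (x 0)))"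
      using s t \<epsilon> by (intro mult_left_mono mult_right_mono) (auto intro: mult_left_mono)
    finally show ?thesis by (simp add: y_def mult.assoc)
  qed simp
qed

text \<open>Near \<open>\<sigma>\<close> the displacement \<open>x = \<phi> s z - \<sigma>\<close>
  nearly solves \<open>x' = m x\<close>, so \<open>x t / x 0\<close> is close to
  \<open>exp (m t)\<close>. The limit is taken in the whole disk because an orbit need not stay in a
  Stolz region.\<close>

theorem BRFP_of_generator_limit:
  assumes gen: "generates G \<phi>" and \<sigma>: "cmod \<sigma> = 1"
    and lim: "((\<lambda>z. G z / (z - \<sigma>)) \<longlongrightarrow> of_real m) (at \<sigma> within ball 0 1)"
  shows "is_BRFP \<phi> \<sigma> (- m)"
proof -
  have quotient: "((\<lambda>z. (\<phi> t z - \<sigma>) / (z - \<sigma>)) \<longlongrightarrow> of_real (exp (m * t))) (at \<sigma> within ball 0 1)"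
    if t: "0 \<le> t" for t
  proof (rule tendstoI)
    fix e :: real assume e: "0 < e"
    have "((\<lambda>\<epsilon>. exp (m * t) * (t * \<epsilon> * exp (\<epsilon> * t))) \<longlongrightarrow> exp (m * t) * (t * 0 * exp (0 * t))) (at_right 0)"
      by (intro tendsto_intros)
    then have "\<forall>\<^sub>F \<epsilon> in at_right 0. exp (m * t) * (t * \<epsilon> * exp (\<epsilon> * t)) < e"
      using e by (intro order_tendstoD(2)) auto
    moreover have "\<forall>\<^sub>F \<epsilon>::real in at_right 0. 0 < \<epsilon>" by (simp add: eventually_at_right_less)
    ultimately have "\<forall>\<^sub>F \<epsilon> in at_right 0. 0 < \<epsilon> \<and> exp (m * t) * (t * \<epsilon> * exp (\<epsilon> * t)) < e"
      by eventually_elim simp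
    then obtain \<epsilon> where \<epsilon>: "0 < \<epsilon>" "exp (m * t) * (t * \<epsilon> * exp (\<epsilon> * t)) < e"
      using eventually_happens' [OF trivial_limit_at_right_real] by blast
    obtain \<delta> where \<delta>: "0 < \<delta>"
      "\<And>z. z \<in> ball 0 1 \<Longrightarrow> z \<noteq> \<sigma> \<Longrightarrow> dist z \<sigma> < \<delta> \<Longrightarrow> dist (G z / (z - \<sigma>)) (of_real m) < \<epsilon>"
      using tendstoD [OF lim \<epsilon>(1)] unfolding eventually_at by blast
    \<comment> \<open>Starting within \<open>d\<close> of \<open>\<sigma>\<close> is exactly the
      smallness condition of \<open>linear_perturbation_bounds\<close>.\<close>
    define d where "d = \<delta> / exp ((\<bar>m\<bar> + \<epsilon>) * t)"
    have "0 < d" using \<delta> by (simp add: d_def)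
    moreover have "dist ((\<phi> t z - \<sigma>) / (z - \<sigma>)) (of_real (exp (m * t))) < e"
      if z: "z \<in> ball 0 1" "z \<noteq> \<sigma>" "dist z \<sigma> < d" for z
    proof -
      define x where "x = (\<lambda>s. \<phi> s z - \<sigma>)"
      have x0: "x 0 = z - \<sigma>"
        using gen z by (simp add: x_def generates_def is_semigroup_def unit_disk_def)
      have "cmod (x t * exp (of_real (- m * t)) - x 0) \<le> t * \<epsilon> * exp (\<epsilon> * t) * cmod (x 0)"
      proof (rule linear_perturbation_bounds [where x' = "\<lambda>s. G (\<phi> s z)" and \<delta> = \<delta>])
        fix s :: real assume s: "0 \<le> s"
        have "((\<lambda>s. \<phi> s z) has_vector_derivative G (\<phi> s z)) (at s within {0..})"
          using gen z s by (auto simp: generates_def unit_disk_def)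
        then show "(x has_vector_derivative G (\<phi> s z)) (at s within {0..})"
          unfolding x_def by (auto intro!: derivative_eq_intros)
        have b: "\<phi> s z \<in> ball 0 1"
          using gen z s by (auto simp: generates_def is_semigroup_def unit_disk_def image_subset_iff)
        then have ne: "\<phi> s z \<noteq> \<sigma>" using \<sigma> by auto
        assume "cmod (x s) < \<delta>"
        then have "cmod (G (\<phi> s z) / x s - of_real m) < \<epsilon>"
          using \<delta>(2) [OF b ne] by (simp add: x_def dist_norm)
        then have "cmod (G (\<phi> s z) / x s - of_real m) * cmod (x s) \<le> \<epsilon> * cmod (x s)"
          by (intro mult_right_mono) auto
        moreover have "(G (\<phi> s z) / x s - of_real m) * x s = G (\<phi> s z) - of_real m * x s"
          using ne by (simp add: x_def left_diff_distrib)
        ultimately show "cmod (G (\<phi> s z) - of_real m * x s) \<le> \<epsilon> * cmod (x s)"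
          by (metis norm_mult)
      next
        show "exp ((\<bar>m\<bar> + \<epsilon>) * t) * cmod (x 0) < \<delta>"
          using z(3) by (simp add: d_def x0 dist_norm field_simps)
      qed (use \<epsilon> t in auto)
      also have "t * \<epsilon> * exp (\<epsilon> * t) * cmod (x 0) = cmod (x 0) * (t * \<epsilon> * exp (\<epsilon> * t))"
        by (simp add: mult_ac)
      finally have *: "cmod (x t * exp (of_real (- m * t)) - x 0) / cmod (x 0) \<le> t * \<epsilon> * exp (\<epsilon> * t)"
        using z(2) by (simp add: x0 field_simps)
      have "(\<phi> t z - \<sigma>) / (z - \<sigma>) - of_real (exp (m * t))
          = of_real (exp (m * t)) * ((x t * exp (of_real (- m * t)) - x 0) / x 0)"
      proof -
        have "complex_of_real (exp (m * t)) * exp (of_real (- m * t)) = 1"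
          by (simp add: exp_of_real [symmetric] exp_minus)
        then have "complex_of_real (exp (m * t)) * (x t * exp (of_real (- m * t)) - x 0)
            = x t - of_real (exp (m * t)) * x 0"
          by (simp add: right_diff_distrib mult.left_commute [of _ "x t"])
        then have "of_real (exp (m * t)) * ((x t * exp (of_real (- m * t)) - x 0) / x 0)
            = (x t - of_real (exp (m * t)) * x 0) / x 0"
          by (simp only: times_divide_eq_right)
        also have "\<dots> = x t / x 0 - of_real (exp (m * t))"
          using z(2) by (simp add: diff_divide_distrib x0)
        finally show ?thesis unfolding x0 by (simp add: x_def)
      qed
      then have "dist ((\<phi> t z - \<sigma>) / (z - \<sigma>)) (of_real (exp (m * t)))
          = exp (m * t) * (cmod (x t * exp (of_real (- m * t)) - x 0) / cmod (x 0))"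
        by (simp only: dist_norm norm_mult norm_divide norm_of_real) simp
      also have "\<dots> \<le> exp (m * t) * (t * \<epsilon> * exp (\<epsilon> * t))"
        using * by (intro mult_left_mono) auto
      finally show ?thesis using \<epsilon> by simp
    qed
    ultimately show "\<forall>\<^sub>F z in at \<sigma> within ball 0 1. dist ((\<phi> t z - \<sigma>) / (z - \<sigma>)) (of_real (exp (m * t))) < e"
      unfolding eventually_at by blast
  qed
  have fixp: "(\<phi> t \<longlongrightarrow> \<sigma>) (at \<sigma> within ball 0 1)" if t: "0 \<le> t" for t
  proof -
    have "((\<lambda>z. (\<phi> t z - \<sigma>) / (z - \<sigma>) * (z - \<sigma>) + \<sigma>) \<longlongrightarrow> of_real (exp (m * t)) * (\<sigma> - \<sigma>) + \<sigma>) (at \<sigma> within ball 0 1)"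
      by (intro tendsto_intros quotient t)
    then have "((\<lambda>z. (\<phi> t z - \<sigma>) / (z - \<sigma>) * (z - \<sigma>) + \<sigma>) \<longlongrightarrow> \<sigma>) (at \<sigma> within ball 0 1)"
      by simp
    then show ?thesis
      by (rule Lim_transform_eventually) (auto simp: eventually_at_filter)
  qed
  have sub: "stolz \<sigma> M \<subseteq> ball 0 1" for M by (auto simp: stolz_def)
  then show ?thesis
    using \<sigma> quotient fixp unfolding is_BRFP_def angular_limit_def
    by (auto intro: tendsto_within_subset [OF _ sub])
qed

text \<open>Multiplying the denominator by \<open>\<sigma> - z\<close> clears the pole and leaves
  the limit \<open>2 c \<sigma>\<close>, so \<open>G z / (z - \<sigma>)\<close> tends to
  \<open>1 / (2 c)\<close>.\<close>

lemma BRFP_of_pole: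
  assumes gen: "generates G \<phi>" and \<sigma>: "cmod \<sigma> = 1" and c: "0 < c"
    and G: "\<And>z. z \<in> ball 0 1 \<Longrightarrow> G z = - z / (of_real c * cayley \<sigma> z + g z)"
    and g: "isCont g \<sigma>"
  shows "is_BRFP \<phi> \<sigma> (- 1 / (2 * c))"
proof -
  have s0: "\<sigma> \<noteq> 0" using \<sigma> by auto
  have "(g \<longlongrightarrow> g \<sigma>) (at \<sigma> within ball 0 1)"
    using g unfolding isCont_def by (rule tendsto_within_subset) simp
  then have lim: "((\<lambda>z. z / (of_real c * (\<sigma> + z) + g z * (\<sigma> - z))) \<longlongrightarrow>
      \<sigma> / (of_real c * (\<sigma> + \<sigma>) + g \<sigma> * (\<sigma> - \<sigma>))) (at \<sigma> within ball 0 1)"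
    using s0 c by (intro tendsto_intros) auto
  have val: "\<sigma> / (of_real c * (\<sigma> + \<sigma>) + g \<sigma> * (\<sigma> - \<sigma>)) = of_real (1 / (2 * c))"
    using s0 c by (simp add: field_simps)
  have "\<forall>\<^sub>F z in at \<sigma> within ball 0 1. z / (of_real c * (\<sigma> + z) + g z * (\<sigma> - z)) = G z / (z - \<sigma>)"
    unfolding eventually_at_filter
  proof (intro always_eventually allI impI)
    fix z assume z: "z \<noteq> \<sigma>" "z \<in> ball 0 1"
    have "of_real c * cayley \<sigma> z + g z = (of_real c * (\<sigma> + z) + g z * (\<sigma> - z)) / (\<sigma> - z)"
      using z by (simp add: cayley_def divide_simps)
    then have "G z = - z * (\<sigma> - z) / (of_real c * (\<sigma> + z) + g z * (\<sigma> - z))"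
      using G [OF z(2)] by simp
    also have "\<dots> = z / (of_real c * (\<sigma> + z) + g z * (\<sigma> - z)) * (z - \<sigma>)"
      by (simp add: algebra_simps)
    finally show "z / (of_real c * (\<sigma> + z) + g z * (\<sigma> - z)) = G z / (z - \<sigma>)"
      using z by simp
  qed
  then have "((\<lambda>z. G z / (z - \<sigma>)) \<longlongrightarrow> of_real (1 / (2 * c))) (at \<sigma> within ball 0 1)"
    by (rule Lim_transform_eventually [OF lim [unfolded val]])
  from BRFP_of_generator_limit [OF gen \<sigma> this] show ?thesis by simp
qed

section \<open>Generators realising the value set\<close>

lemma cayley_comp_holomorphic:
  assumes "cmod \<eta> \<le> 1"
  shows "(\<lambda>z. cayley 1 (\<eta> * z)) holomorphic_on ball 0 1"
proof -
  have "1 - \<eta> * z \<noteq> 0" if "z \<in> ball 0 1" for z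
  proof -
    have "cmod (\<eta> * z) < 1"
      using assms that mult_left_le_one_le [of "cmod z" "cmod \<eta>"] by (simp add: norm_mult)
    then show ?thesis by auto
  qed
  then show ?thesis unfolding cayley_def by (intro holomorphic_intros) auto
qed

lemma p0_holomorphic:
  assumes "\<forall>k\<in>{1..n}. cmod (\<sigma> k) = 1"
  shows "p0 n \<sigma> lam holomorphic_on ball 0 1"
proof -
  have "\<sigma> k \<notin> ball 0 1" if "k \<in> {1..n}" for k using assms that by simp
  then show ?thesis unfolding p0_cayley [abs_def] by (intro holomorphic_intros) auto
qed

lemma Re_p0_pos:
  assumes "n \<ge> 1" "\<forall>k\<in>{1..n}. cmod (\<sigma> k) = 1" "\<forall>k\<in>{1..n}. lam k < 0" "z \<in> ball 0 1"
  shows "0 < Re (p0 n \<sigma> lam z)"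
proof -
  have "Re (p0 n \<sigma> lam z) = (\<Sum>k\<in>{1..n}. 1 / (2 * \<bar>lam k\<bar>) * Re (cayley (\<sigma> k) z))"
    unfolding p0_cayley Re_sum by (intro sum.cong refl) (simp del: of_real_divide)
  also have "\<dots> > 0"
  proof (intro sum_pos mult_pos_pos)
    fix k assume "k \<in> {1..n}"
    then have "lam k < 0" "cmod (\<sigma> k) = 1" using assms by blast+
    then show "0 < 1 / (2 * \<bar>lam k\<bar>)" "0 < Re (cayley (\<sigma> k) z)"
      using Re_cayley_pos assms(4) by auto
  qed (use assms in auto)
  finally show ?thesis .
qed

lemma p0_0:
  assumes "\<forall>k\<in>{1..n}. cmod (\<sigma> k) = 1"
  shows "p0 n \<sigma> lam 0 = of_real ((1/2) * (\<Sum>k\<in>{1..n}. 1 / \<bar>lam k\<bar>))"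
proof -
  have "\<sigma> k \<noteq> 0" if "k \<in> {1..n}" for k using assms that norm_zero zero_neq_one by metis
  then have "p0 n \<sigma> lam 0 = (\<Sum>k\<in>{1..n}. complex_of_real (1 / (2 * \<bar>lam k\<bar>)))"
    unfolding p0_def by (intro sum.cong) auto
  then show ?thesis by (simp add: sum_distrib_left)
qed

lemma deriv_p0_0:
  assumes "\<forall>k\<in>{1..n}. cmod (\<sigma> k) = 1"
  shows "(p0 n \<sigma> lam has_field_derivative (\<Sum>k\<in>{1..n}. cnj (\<sigma> k) / complex_of_real \<bar>lam k\<bar>)) (at 0)"
proof -
  have s0: "\<sigma> k \<noteq> 0" if "k \<in> {1..n}" for k using assms that norm_zero zero_neq_one by metis
  have "(p0 n \<sigma> lam has_field_derivative
      (\<Sum>k\<in>{1..n}. complex_of_real (1 / (2 * \<bar>lam k\<bar>)) * (2 * \<sigma> k / (\<sigma> k - 0)\<^sup>2))) (at 0)"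
    unfolding p0_cayley [abs_def] using s0
    by (intro DERIV_sum DERIV_cmult cayley_deriv) auto
  moreover have "complex_of_real (1 / (2 * \<bar>lam k\<bar>)) * (2 * \<sigma> k / (\<sigma> k - 0)\<^sup>2) = cnj (\<sigma> k) / complex_of_real \<bar>lam k\<bar>"
    if "k \<in> {1..n}" for k
  proof -
    have "cnj (\<sigma> k) * \<sigma> k = 1"
      using assms that by (simp add: complex_norm_square [symmetric] mult.commute)
    then have "2 * \<sigma> k / (\<sigma> k - 0)\<^sup>2 = 2 * cnj (\<sigma> k)"
      using s0 [OF that] by (simp add: power2_eq_square divide_simps)
    then show ?thesis by simp
  qed
  ultimately show ?thesis by (metis (no_types, lifting) sum.cong)
qed

text \<open>\<open>cayley 1 (\<eta> z)\<close> ranges from the constant 1 at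
  \<open>\<eta> = 0\<close> to the kernel at \<open>cnj \<eta>\<close> for
  \<open>|\<eta>| = 1\<close>. In every case \<open>q\<close> has at each node a pole of at least
  the mass in \<open>p0\<close>, so \<open>BRFP_of_pole\<close> applies.\<close>

theorem herglotz_imp_Gen0_FL:
  assumes n: "n \<ge> 1" and inj: "inj_on \<sigma> {1..n}" and \<sigma>: "\<forall>k\<in>{1..n}. cmod (\<sigma> k) = 1"
    and neg: "\<forall>k\<in>{1..n}. lam k < 0" and a: "0 \<le> a" and \<eta>: "cmod \<eta> \<le> 1"
  shows "(\<lambda>z. - z / (p0 n \<sigma> lam z + (of_real a * cayley 1 (\<eta> * z) + \<i> * of_real b))) \<in> Gen0_FL n \<sigma> lam"
    (is "?G \<in> _")
proof -
  define q where "q = (\<lambda>z. p0 n \<sigma> lam z + (of_real a * cayley 1 (\<eta> * z) + \<i> * of_real b))"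
  have holq: "q holomorphic_on ball 0 1"
    unfolding q_def using p0_holomorphic [OF \<sigma>] cayley_comp_holomorphic [OF \<eta>] by (intro holomorphic_intros)
  have qpos: "0 < Re (q z)" if z: "z \<in> ball 0 1" for z
  proof -
    have "\<eta> * z \<in> ball 0 1"
      using z \<eta> mult_left_le_one_le [of "cmod z" "cmod \<eta>"] by (simp add: norm_mult)
    then have "0 < Re (cayley 1 (\<eta> * z))" by (intro Re_cayley_pos) auto
    then have "0 \<le> a * Re (cayley 1 (\<eta> * z))" using a by simp
    then show ?thesis using Re_p0_pos [OF n \<sigma> neg z] by (simp add: q_def)
  qed
  obtain \<phi> where gen: "generates (\<lambda>z. - z / q z) \<phi>" and fix0: "\<And>t. \<phi> t 0 = 0"
    using Re_pos_generates [OF holq qpos] by metis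
  have "\<exists>\<mu>. is_BRFP \<phi> (\<sigma> k) \<mu> \<and> lam k \<le> \<mu> \<and> \<mu> \<le> 0" if k: "k \<in> {1..n}" for k
  proof -
    have sk: "cmod (\<sigma> k) = 1" using \<sigma> k by blast
    have lk: "lam k < 0" using neg k by blast
    define ak where "ak = 1 / (2 * \<bar>lam k\<bar>)"
    have ak: "0 < ak" using lk by (simp add: ak_def)
    define R where "R = (\<lambda>z. \<Sum>j\<in>{1..n} - {k}. complex_of_real (1 / (2 * \<bar>lam j\<bar>)) * cayley (\<sigma> j) z)"
    have split: "p0 n \<sigma> lam z = of_real ak * cayley (\<sigma> k) z + R z" for z
      unfolding p0_cayley R_def ak_def using k by (simp add: sum.remove)
    have "\<sigma> j \<noteq> \<sigma> k" if "j \<in> {1..n} - {k}" for j using inj k that by (auto dest: inj_onD)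
    then have contR: "isCont R (\<sigma> k)"
      unfolding R_def cayley_def by (intro continuous_intros) auto
    obtain c g where cg: "ak \<le> c" "isCont g (\<sigma> k)" "\<And>z. q z = of_real c * cayley (\<sigma> k) z + g z"
    \<comment> \<open>Equality means that the added kernel has its pole at this very node and raises
      the mass by \<open>a\<close>; otherwise it is continuous there.\<close>
    proof (cases "\<eta> * \<sigma> k = 1")
      case True
      have "cayley 1 (\<eta> * z) = cayley (\<sigma> k) z" for z
      proof -
        have "\<eta> \<noteq> 0" "\<eta> * (\<sigma> k + z) = 1 + \<eta> * z" "\<eta> * (\<sigma> k - z) = 1 - \<eta> * z"
          using True by (auto simp: algebra_simps)
        then show ?thesis by (metis cayley_def mult_divide_mult_cancel_left)
      qed
      then have "q z = of_real (ak + a) * cayley (\<sigma> k) z + (R z + \<i> * of_real b)" for z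
        by (simp add: q_def split algebra_simps)
      moreover have "isCont (\<lambda>z. R z + \<i> * of_real b) (\<sigma> k)" using contR by (intro continuous_intros)
      ultimately show thesis using that a by (meson le_add_same_cancel1)
    next
      case False
      then have "isCont (\<lambda>z. R z + (of_real a * cayley 1 (\<eta> * z) + \<i> * of_real b)) (\<sigma> k)"
        unfolding cayley_def using contR by (intro continuous_intros) auto
      then show thesis using that [of ak] by (simp add: q_def split add.assoc)
    qed
    have c0: "0 < c" using cg ak by simp
    have "is_BRFP \<phi> (\<sigma> k) (- 1 / (2 * c))"
      using cg by (intro BRFP_of_pole [OF gen sk c0]) auto
    moreover have "lam k \<le> - 1 / (2 * c)"
    proof -
      have "1 / (2 * c) \<le> 1 / (2 * ak)" using cg ak by (intro divide_left_mono) auto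
      also have "\<dots> = - lam k" using lk by (simp add: ak_def)
      finally show ?thesis by simp
    qed
    moreover have "- 1 / (2 * c) \<le> 0" using c0 by simp
    ultimately show ?thesis by blast
  qed
  then show ?thesis using gen fix0 unfolding Gen0_FL_def q_def by blast
qed

lemma zero_in_Gen0_FL:
  assumes "\<forall>k\<in>{1..n}. cmod (\<sigma> k) = 1" "\<forall>k\<in>{1..n}. lam k < 0"
  shows "(\<lambda>z. 0) \<in> Gen0_FL n \<sigma> lam"
proof -
  define \<phi> where "\<phi> = (\<lambda>(t::real) (z::complex). z)"
  have gen: "generates (\<lambda>z. 0) \<phi>"
    unfolding generates_def is_semigroup_def \<phi>_def by auto
  have "is_BRFP \<phi> (\<sigma> k) (- 0)" if "k \<in> {1..n}" for k
    using assms that by (intro BRFP_of_generator_limit [OF gen]) auto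
  then have "\<forall>k\<in>{1..n}. \<exists>\<mu>. is_BRFP \<phi> (\<sigma> k) \<mu> \<and> lam k \<le> \<mu> \<and> \<mu> \<le> 0"
    using assms(2) by (metis less_imp_le minus_zero order_refl)
  then show ?thesis using gen unfolding Gen0_FL_def by (auto simp: \<phi>_def)
qed

section \<open>The value set\<close>

text \<open>Inversion maps the circle through 0 with centre \<open>r\<close> to the vertical line at
  \<open>1 / (2 * r)\<close>.\<close>

lemma disk_inverse_iff:
  assumes "0 < r" "\<omega> \<noteq> 0"
  shows "cmod (\<omega> - of_real r) \<le> r \<longleftrightarrow> 1 / (2 * r) \<le> Re (1 / \<omega>)"
    and "cmod (\<omega> - of_real r) < r \<longleftrightarrow> 1 / (2 * r) < Re (1 / \<omega>)"
proof -
  have w: "0 < (cmod \<omega>)\<^sup>2" using assms by simp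
  have "(cmod (\<omega> - of_real r))\<^sup>2 = (cmod \<omega>)\<^sup>2 - 2 * r * Re \<omega> + r\<^sup>2"
    unfolding cmod_power2 by (simp add: power2_eq_square algebra_simps)
  moreover have "1 / (2 * r) \<le> Re (1 / \<omega>) \<longleftrightarrow> (cmod \<omega>)\<^sup>2 \<le> 2 * r * Re \<omega>"
    "1 / (2 * r) < Re (1 / \<omega>) \<longleftrightarrow> (cmod \<omega>)\<^sup>2 < 2 * r * Re \<omega>"
  proof -
    have inv: "Re (1 / \<omega>) = Re \<omega> / (cmod \<omega>)\<^sup>2" by (simp add: Re_divide cmod_power2)
    show "1 / (2 * r) \<le> Re (1 / \<omega>) \<longleftrightarrow> (cmod \<omega>)\<^sup>2 \<le> 2 * r * Re \<omega>"
      "1 / (2 * r) < Re (1 / \<omega>) \<longleftrightarrow> (cmod \<omega>)\<^sup>2 < 2 * r * Re \<omega>"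
      unfolding inv using assms(1) w by (simp_all add: divide_simps mult_ac)
  qed
  moreover have "cmod (\<omega> - of_real r) \<le> r \<longleftrightarrow> (cmod (\<omega> - of_real r))\<^sup>2 \<le> r\<^sup>2"
    using assms by (simp add: abs_le_square_iff [symmetric])
  moreover have "cmod (\<omega> - of_real r) < r \<longleftrightarrow> (cmod (\<omega> - of_real r))\<^sup>2 < r\<^sup>2"
    using assms by (simp add: power_mono_iff flip: not_le)
  ultimately show "cmod (\<omega> - of_real r) \<le> r \<longleftrightarrow> 1 / (2 * r) \<le> Re (1 / \<omega>)"
    and "cmod (\<omega> - of_real r) < r \<longleftrightarrow> 1 / (2 * r) < Re (1 / \<omega>)"
    by simp_all
qed

text \<open>For unimodular nodes \<open>mass\<close> is twice the value of \<open>p0\<close> at 0,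
  and \<open>moment\<close> its derivative there; see \<open>p0_0\<close> and
  \<open>deriv_p0_0\<close>.\<close>

abbreviation mass :: "nat \<Rightarrow> (nat \<Rightarrow> real) \<Rightarrow> real" where
  "mass n lam \<equiv> \<Sum>k\<in>{1..n}. 1 / \<bar>lam k\<bar>"

abbreviation moment :: "nat \<Rightarrow> (nat \<Rightarrow> complex) \<Rightarrow> (nat \<Rightarrow> real) \<Rightarrow> complex" where
  "moment n \<sigma> lam \<equiv> \<Sum>k\<in>{1..n}. cnj (\<sigma> k) / complex_of_real \<bar>lam k\<bar>"

lemma mass_pos:
  assumes "n \<ge> 1" "\<forall>k\<in>{1..n}. lam k < 0"
  shows "0 < mass n lam"
proof (rule sum_pos)
  fix k assume "k \<in> {1..n}"
  then have "lam k < 0" using assms by blast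
  then show "0 < 1 / \<bar>lam k\<bar>" by simp
qed (use assms in auto)

text \<open>\<open>Re (ellhat n lam \<omega>)\<close> is the distance of \<open>1 / \<omega>\<close>
  beyond the line at \<open>1 / (2 * rad n lam)\<close>, with sign. The point 0 is listed apart,
  since \<open>1 / 0 = 0\<close> makes \<open>ellhat\<close> negative there.\<close>

lemma Omega_iff:
  assumes "n \<ge> 1" "\<forall>k\<in>{1..n}. lam k < 0"
  shows "\<omega> \<in> Omega n lam \<longleftrightarrow> \<omega> = 0 \<or> 0 \<le> Re (ellhat n lam \<omega>)"
    and "\<omega> \<noteq> 0 \<Longrightarrow> \<omega> \<in> interior (Omega n lam) \<longleftrightarrow> 0 < Re (ellhat n lam \<omega>)"
    and "\<omega> \<noteq> 0 \<Longrightarrow> \<omega> \<in> frontier (Omega n lam) \<longleftrightarrow> Re (ellhat n lam \<omega>) = 0"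
proof -
  have m: "0 < mass n lam" by (rule mass_pos [OF assms])
  then have r: "0 < rad n lam" "1 / (2 * rad n lam) = mass n lam / 2" by (simp_all add: rad_def)
  have O: "Omega n lam = cball (of_real (rad n lam)) (rad n lam)"
    by (auto simp: Omega_def dist_norm norm_minus_commute)
  have ell: "Re (ellhat n lam \<omega>) = Re (1 / \<omega>) - mass n lam / 2" by (simp add: ellhat_def)
  have i: "\<omega> \<in> interior (Omega n lam) \<longleftrightarrow> cmod (\<omega> - of_real (rad n lam)) < rad n lam"
    and f: "\<omega> \<in> Omega n lam \<longleftrightarrow> cmod (\<omega> - of_real (rad n lam)) \<le> rad n lam"
    by (auto simp: O dist_norm norm_minus_commute)
  show 1: "\<omega> \<in> Omega n lam \<longleftrightarrow> \<omega> = 0 \<or> 0 \<le> Re (ellhat n lam \<omega>)"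
    unfolding f ell using disk_inverse_iff(1) [OF r(1), of \<omega>] r by (cases "\<omega> = 0") auto
  show 2: "\<omega> \<in> interior (Omega n lam) \<longleftrightarrow> 0 < Re (ellhat n lam \<omega>)" if "\<omega> \<noteq> 0"
    unfolding i ell using disk_inverse_iff(2) [OF r(1) that] r by auto
  have "closed (Omega n lam)" by (simp add: O)
  then show "\<omega> \<in> frontier (Omega n lam) \<longleftrightarrow> Re (ellhat n lam \<omega>) = 0" if "\<omega> \<noteq> 0"
    unfolding frontier_def using 1 2 [OF that] that by auto
qed

lemma Zset_iff:
  assumes "\<omega> \<noteq> 0"
  shows "\<zeta> \<in> Zset n \<sigma> lam \<omega> \<longleftrightarrow>
    cmod (\<zeta> / (2 * \<omega>\<^sup>2) - moment n \<sigma> lam) \<le> 2 * Re (ellhat n lam \<omega>)"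
  using assms by (simp add: Zset_def ellhat_def)

lemma Zset_scaled:
  fixes \<omega> \<zeta> M :: complex and s :: real
  assumes "\<omega> \<noteq> 0"
  shows "2 * (cmod \<omega>)\<^sup>2 * cmod (\<zeta> / (2 * \<omega>\<^sup>2) - M) = cmod (\<zeta> - 2 * \<omega>\<^sup>2 * M)"
    and "2 * (cmod \<omega>)\<^sup>2 * (2 * Re (1 / \<omega> - of_real ((1/2) * s))) = 4 * Re \<omega> - 2 * (cmod \<omega>)\<^sup>2 * s"
proof -
  have "\<zeta> - 2 * \<omega>\<^sup>2 * M = 2 * \<omega>\<^sup>2 * (\<zeta> / (2 * \<omega>\<^sup>2) - M)" using assms by (simp add: field_simps)
  then show "2 * (cmod \<omega>)\<^sup>2 * cmod (\<zeta> / (2 * \<omega>\<^sup>2) - M) = cmod (\<zeta> - 2 * \<omega>\<^sup>2 * M)"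
    by (simp only: norm_mult norm_power norm_numeral)
  have "Re (1 / \<omega> - of_real ((1/2) * s)) = Re \<omega> / (cmod \<omega>)\<^sup>2 - s / 2"
    by (simp add: Re_divide cmod_power2)
  moreover have "2 * (cmod \<omega>)\<^sup>2 * (2 * (Re \<omega> / (cmod \<omega>)\<^sup>2 - s / 2)) = 4 * Re \<omega> - 2 * (cmod \<omega>)\<^sup>2 * s"
    using assms by (simp add: right_diff_distrib)
  ultimately show "2 * (cmod \<omega>)\<^sup>2 * (2 * Re (1 / \<omega> - of_real ((1/2) * s))) = 4 * Re \<omega> - 2 * (cmod \<omega>)\<^sup>2 * s"
    by (simp only:)
qed

text \<open>Clearing the denominator \<open>\<omega>\<^sup>2\<close> turns the description of the value set into one that
  covers \<open>\<omega> = 0\<close> and is visibly closed.\<close>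

lemma value_set_polynomial:
  assumes "n \<ge> 1" "\<forall>k\<in>{1..n}. lam k < 0"
  shows "\<omega> \<in> Omega n lam \<and> \<zeta> \<in> Zset n \<sigma> lam \<omega> \<longleftrightarrow>
      cmod (\<zeta> - 2 * \<omega>\<^sup>2 * moment n \<sigma> lam) \<le> 4 * Re \<omega> - 2 * (cmod \<omega>)\<^sup>2 * mass n lam"
proof (cases "\<omega> = 0")
  case True
  then show ?thesis using Omega_iff(1) [OF assms] by (simp add: Zset_def)
next
  case False
  then have w: "0 < 2 * (cmod \<omega>)\<^sup>2" by simp
  have "\<omega> \<in> Omega n lam \<and> \<zeta> \<in> Zset n \<sigma> lam \<omega> \<longleftrightarrow>
      cmod (\<zeta> / (2 * \<omega>\<^sup>2) - moment n \<sigma> lam) \<le> 2 * Re (ellhat n lam \<omega>)"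
    unfolding Omega_iff(1) [OF assms] Zset_iff [OF False] 
    using False norm_ge_zero [of "\<zeta> / (2 * \<omega>\<^sup>2) - moment n \<sigma> lam"] by linarith
  also have "\<dots> \<longleftrightarrow> 2 * (cmod \<omega>)\<^sup>2 * cmod (\<zeta> / (2 * \<omega>\<^sup>2) - moment n \<sigma> lam)
      \<le> 2 * (cmod \<omega>)\<^sup>2 * (2 * Re (ellhat n lam \<omega>))"
    using w by (simp only: mult_le_cancel_left_pos)
  finally show ?thesis unfolding Zset_scaled(1) [OF False] ellhat_def Zset_scaled(2) [OF False] .
qed

text \<open>Both sides are continuous, so \<open>V\<close> is closed, and strict inequality cuts out
  an open part of \<open>V\<close>, which contains no frontier point.\<close>

lemma frontier_value_set:
  fixes V :: "(complex \<times> complex) set"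
  assumes V: "V = {(\<zeta>, \<omega>). cmod (\<zeta> - 2 * \<omega>\<^sup>2 * M) \<le> 4 * Re \<omega> - 2 * (cmod \<omega>)\<^sup>2 * s}"
    and p: "(\<zeta>, \<omega>) \<in> frontier V"
  shows "(\<zeta>, \<omega>) \<in> V" "cmod (\<zeta> - 2 * \<omega>\<^sup>2 * M) = 4 * Re \<omega> - 2 * (cmod \<omega>)\<^sup>2 * s"
proof -
  define f where "f = (\<lambda>p. cmod (fst p - 2 * (snd p)\<^sup>2 * M))"
  define g where "g = (\<lambda>p :: complex \<times> complex. 4 * Re (snd p) - 2 * (cmod (snd p))\<^sup>2 * s)"
  have cont: "continuous_on UNIV f" "continuous_on UNIV g"
    unfolding f_def g_def by (intro continuous_intros)+
  have Vfg: "V = {p. f p \<le> g p}" by (auto simp: V f_def g_def)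
  have "closed V" unfolding Vfg using cont by (rule closed_Collect_le)
  then show V1: "(\<zeta>, \<omega>) \<in> V" using p frontier_subset_closed by blast
  have "open {p. f p < g p}" using cont by (rule open_Collect_less)
  moreover have "{p. f p < g p} \<subseteq> V" by (auto simp: Vfg)
  ultimately have "{p. f p < g p} \<subseteq> interior V" by (rule interior_maximal [rotated])
  then have "\<not> f (\<zeta>, \<omega>) < g (\<zeta>, \<omega>)" using p by (auto simp: frontier_def)
  then show "cmod (\<zeta> - 2 * \<omega>\<^sup>2 * M) = 4 * Re \<omega> - 2 * (cmod \<omega>)\<^sup>2 * s"
    using V1 by (auto simp: Vfg f_def g_def)
qed

text \<open>Here \<open>p = q - p0\<close>. Inverting \<open>Vpt_quotient\<close> gives
  \<open>q 0 = 1 / \<omega>\<close> and \<open>deriv q 0 = \<zeta> / (2 \<omega>^2)\<close>, from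
  which the data of \<open>p0\<close> are subtracted.\<close>

lemma Gen0_FL_cases:
  assumes n: "n \<ge> 1" and inj: "inj_on \<sigma> {1..n}" and \<sigma>: "\<forall>k\<in>{1..n}. cmod (\<sigma> k) = 1"
    and neg: "\<forall>k\<in>{1..n}. lam k < 0" and G: "G \<in> Gen0_FL n \<sigma> lam" and V: "Vpt G = (\<zeta>, \<omega>)"
  obtains (zero) "\<zeta> = 0" "\<omega> = 0" "\<And>z. z \<in> ball 0 1 \<Longrightarrow> G z = 0"
  | (herglotz) p where "\<omega> \<noteq> 0" "p holomorphic_on ball 0 1" "\<And>z. z \<in> ball 0 1 \<Longrightarrow> 0 \<le> Re (p z)"
    "\<And>z. z \<in> ball 0 1 \<Longrightarrow> G z = - z / (p z + p0 n \<sigma> lam z)"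
    "p 0 = ellhat n lam \<omega>" "deriv p 0 = \<zeta> / (2 * \<omega>\<^sup>2) - moment n \<sigma> lam"
  using Gen0_FL_imp_herglotz [OF n inj neg G]
proof (elim disjE exE conjE)
  assume G0: "\<forall>z\<in>ball 0 1. G z = 0"
  then have "Vpt G = Vpt (\<lambda>z. 0)"
  proof -
    have ev: "\<forall>\<^sub>F z in nhds (0::complex). z \<in> ball 0 1" by (intro eventually_nhds_in_open) auto
    have "deriv G z = 0" if "z \<in> ball 0 1" for z
    proof -
      have "\<forall>\<^sub>F w in nhds z. w \<in> ball 0 1" using that by (intro eventually_nhds_in_open) auto
      then have "\<forall>\<^sub>F w in nhds z. G w = 0" by eventually_elim (use G0 in blast)
      then have "deriv G z = deriv (\<lambda>w. 0) z" by (rule deriv_cong_ev) simp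
      then show ?thesis by simp
    qed
    moreover from this have "\<forall>\<^sub>F z in nhds 0. deriv G z = 0" using ev by (auto elim: eventually_mono)
    then have "deriv (deriv G) 0 = deriv (\<lambda>w. 0) 0" by (rule deriv_cong_ev) simp
    ultimately show ?thesis by (simp add: Vpt_def)
  qed
  then have "(\<zeta>, \<omega>) = (0, 0)" using V by (simp add: Vpt_def)
  then show thesis using G0 zero by blast
next
  fix q assume holq: "q holomorphic_on ball 0 1" and
    q: "\<forall>z\<in>ball 0 1. 0 < Re (q z) \<and> G z = - z / q z \<and> 0 \<le> Re (q z - p0 n \<sigma> lam z)"
  have ne: "q z \<noteq> 0" if "z \<in> ball 0 1" for z using q that by force
  have "(\<zeta>, \<omega>) = (2 * deriv q 0 / (q 0)\<^sup>2, 1 / q 0)"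
    using Vpt_quotient [OF holq ne, of G] q V by simp
  then have \<zeta>: "\<zeta> = 2 * deriv q 0 / (q 0)\<^sup>2" and \<omega>: "\<omega> = 1 / q 0" by auto
  have q0: "q 0 \<noteq> 0" using ne by simp
  define p where "p = (\<lambda>z. q z - p0 n \<sigma> lam z)"
  have "(q has_field_derivative deriv q 0) (at 0)"
    using holq by (rule holomorphic_derivI) auto
  then have "(p has_field_derivative deriv q 0 - moment n \<sigma> lam) (at 0)"
    unfolding p_def by (intro DERIV_diff deriv_p0_0 [OF \<sigma>])
  then have "deriv p 0 = deriv q 0 - moment n \<sigma> lam" by (rule DERIV_imp_deriv)
  moreover have "\<zeta> / (2 * \<omega>\<^sup>2) = deriv q 0"
    using q0 by (simp add: \<zeta> \<omega> power2_eq_square field_simps)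
  ultimately have "deriv p 0 = \<zeta> / (2 * \<omega>\<^sup>2) - moment n \<sigma> lam" by simp
  moreover have "p 0 = ellhat n lam \<omega>"
    by (simp add: p_def p0_0 [OF \<sigma>] ellhat_def \<omega>)
  moreover have "p holomorphic_on ball 0 1"
    unfolding p_def using holq p0_holomorphic [OF \<sigma>] by (intro holomorphic_intros)
  ultimately show thesis
    using q0 q by (intro herglotz [of p]) (auto simp: p_def \<omega>)
qed

text \<open>Divided by \<open>2 |\<omega>|^2\<close>, the hypothesis is equality in
  \<open>caratheodory_coefficient\<close> for \<open>p\<close>, which fixes \<open>p\<close> up to
  the point \<open>s\<close>. The explicit formula for \<open>s\<close> is recorded for the
  uniqueness claim.\<close>

lemma Gen0_FL_extremal:
  assumes n: "n \<ge> 1" and inj: "inj_on \<sigma> {1..n}" and \<sigma>: "\<forall>k\<in>{1..n}. cmod (\<sigma> k) = 1"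
    and neg: "\<forall>k\<in>{1..n}. lam k < 0" and G: "G \<in> Gen0_FL n \<sigma> lam" and V: "Vpt G = (\<zeta>, \<omega>)"
    and eq: "cmod (\<zeta> - 2 * \<omega>\<^sup>2 * moment n \<sigma> lam) = 4 * Re \<omega> - 2 * (cmod \<omega>)\<^sup>2 * mass n lam"
  obtains "\<omega> = 0" "\<And>z. z \<in> ball 0 1 \<Longrightarrow> G z = 0"
  | "\<omega> \<noteq> 0" "Re (ellhat n lam \<omega>) = 0"
    "\<And>z. z \<in> ball 0 1 \<Longrightarrow> G z = - z / (\<i> * of_real (Im (ellhat n lam \<omega>)) + p0 n \<sigma> lam z)"
  | s where "\<omega> \<noteq> 0" "0 < Re (ellhat n lam \<omega>)" "cmod s = 1"
    "s = cnj ((\<zeta> / (2 * \<omega>\<^sup>2) - moment n \<sigma> lam) / (2 * of_real (Re (ellhat n lam \<omega>))))"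
    "\<And>z. z \<in> ball 0 1 \<Longrightarrow> G z = - z / ((s + z) / (s - z) * of_real (Re (ellhat n lam \<omega>))
        + \<i> * of_real (Im (ellhat n lam \<omega>)) + p0 n \<sigma> lam z)"
proof (cases rule: Gen0_FL_cases [OF n inj \<sigma> neg G V])
  case 1
  then show thesis using that(1) by blast
next
  case herglotz: (2 p)
  let ?L = "ellhat n lam \<omega>"
  have w: "2 * (cmod \<omega>)\<^sup>2 \<noteq> 0" using herglotz(1) by simp
  have "2 * (cmod \<omega>)\<^sup>2 * cmod (deriv p 0) = 2 * (cmod \<omega>)\<^sup>2 * (2 * Re ?L)"
    unfolding herglotz(6) ellhat_def Zset_scaled [OF herglotz(1)] by (rule eq)
  then have "cmod (deriv p 0) = 2 * Re (p 0)"
    using w herglotz(5) by (metis mult_left_cancel)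
  from caratheodory_coefficient(2) [OF herglotz(2,3) this] obtain s where s: "cmod s = 1"
    "\<And>z. z \<in> ball 0 1 \<Longrightarrow> p z = of_real (Re ?L) * cayley s z + \<i> * of_real (Im ?L)"
    unfolding herglotz(5) by blast
  have "0 \<le> Re ?L" using herglotz(3) [of 0] herglotz(5) by simp
  then consider "Re ?L = 0" | "0 < Re ?L" by linarith
  then show thesis
  proof cases
    case 1
    show thesis
      by (rule that(2)) (use herglotz(1,4) s(2) 1 in auto)
  next
    case 2
    have "s \<noteq> 0" using s by auto
    have "((\<lambda>z. of_real (Re ?L) * cayley s z + \<i> * of_real (Im ?L)) has_field_derivative
        of_real (Re ?L) * (2 * s / (s - 0)\<^sup>2) + 0) (at 0)"
      using \<open>s \<noteq> 0\<close> by (intro DERIV_add DERIV_cmult cayley_deriv DERIV_const) auto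
    then have "deriv (\<lambda>z. of_real (Re ?L) * cayley s z + \<i> * of_real (Im ?L)) 0
        = of_real (Re ?L) * (2 * s / (s - 0)\<^sup>2) + 0"
      by (rule DERIV_imp_deriv)
    moreover have "\<forall>\<^sub>F z in nhds (0::complex). z \<in> ball 0 1" by (intro eventually_nhds_in_open) auto
    then have "\<forall>\<^sub>F z in nhds 0. p z = of_real (Re ?L) * cayley s z + \<i> * of_real (Im ?L)"
      by eventually_elim (rule s(2))
    then have "deriv p 0 = deriv (\<lambda>z. of_real (Re ?L) * cayley s z + \<i> * of_real (Im ?L)) 0"
      by (rule deriv_cong_ev) simp
    ultimately have dp: "deriv p 0 = 2 * of_real (Re ?L) / s"
      using \<open>s \<noteq> 0\<close> by (simp add: power2_eq_square)
    \<comment> \<open>Conjugation inverts \<open>s\<close>, so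
      \<open>deriv p 0 = 2 Re ?L / s\<close> determines \<open>s\<close> from \<open>\<zeta>\<close>
      and \<open>\<omega>\<close> alone.\<close>
    have "s * cnj s = 1" using s by (simp add: complex_norm_square [symmetric])
    then have "1 / s = cnj s" using \<open>s \<noteq> 0\<close> by (simp add: field_simps)
    moreover have "deriv p 0 / (2 * of_real (Re ?L)) = 1 / s" using 2 by (simp add: dp)
    ultimately have "s = cnj (deriv p 0 / (2 * of_real (Re ?L)))" by simp
    then have "s = cnj ((\<zeta> / (2 * \<omega>\<^sup>2) - moment n \<sigma> lam) / (2 * of_real (Re ?L)))"
      unfolding herglotz(6) .
    then show thesis
      by (rule that(3) [OF herglotz(1) 2 s(1)])
        (simp only: herglotz(4) s(2) cayley_def mult.commute)
  qed
qed

text \<open>At 0 the function \<open>a cayley 1 (\<eta> z) + i b\<close> has value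
  \<open>a + i b\<close> and derivative \<open>2 a \<eta>\<close>; matching these with
  \<open>ellhat\<close> and \<open>d\<close> dictates the parameters.\<close>

lemma value_set_attained:
  assumes n: "n \<ge> 1" and inj: "inj_on \<sigma> {1..n}" and \<sigma>: "\<forall>k\<in>{1..n}. cmod (\<sigma> k) = 1"
    and neg: "\<forall>k\<in>{1..n}. lam k < 0" and \<omega>: "\<omega> \<in> Omega n lam" and \<zeta>: "\<zeta> \<in> Zset n \<sigma> lam \<omega>"
  shows "(\<zeta>, \<omega>) \<in> Vpt ` Gen0_FL n \<sigma> lam"
proof (cases "\<omega> = 0")
  case True
  then have "(\<zeta>, \<omega>) = Vpt (\<lambda>z. 0)" using \<zeta> by (simp add: Vpt_def Zset_def)
  then show ?thesis using zero_in_Gen0_FL [OF \<sigma> neg] by (rule image_eqI)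
next
  case False
  define a where "a = Re (ellhat n lam \<omega>)"
  define b where "b = Im (ellhat n lam \<omega>)"
  define d where "d = \<zeta> / (2 * \<omega>\<^sup>2) - moment n \<sigma> lam"
  \<comment> \<open>For \<open>a = 0\<close> the division returns 0, which fits because then
    \<open>d = 0\<close>. Otherwise \<open>|\<eta>| \<le> 1\<close> is membership in
    \<open>Zset\<close>.\<close>
  define \<eta> where "\<eta> = d / of_real (2 * a)"
  have a: "0 \<le> a" using \<omega> False Omega_iff(1) [OF n neg] by (simp add: a_def)
  have d: "cmod d \<le> 2 * a" using \<zeta> Zset_iff [OF False] by (simp add: a_def d_def)
  have \<eta>: "cmod \<eta> \<le> 1"
    using a d by (cases "a = 0") (auto simp: \<eta>_def norm_divide norm_mult)
  have a\<eta>: "of_real (2 * a) * \<eta> = d"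
    using d by (cases "a = 0") (auto simp: \<eta>_def)
  define q where "q = (\<lambda>z. p0 n \<sigma> lam z + (of_real a * cayley 1 (\<eta> * z) + \<i> * of_real b))"
  have holq: "q holomorphic_on ball 0 1"
    unfolding q_def using p0_holomorphic [OF \<sigma>] cayley_comp_holomorphic [OF \<eta>] by (intro holomorphic_intros)
  have ne: "q z \<noteq> 0" if z: "z \<in> ball 0 1" for z
  proof -
    have "\<eta> * z \<in> ball 0 1"
      using z \<eta> mult_left_le_one_le [of "cmod z" "cmod \<eta>"] by (simp add: norm_mult)
    then have "0 < Re (cayley 1 (\<eta> * z))" by (intro Re_cayley_pos) auto
    then have "0 \<le> a * Re (cayley 1 (\<eta> * z))" using a by simp
    then have "0 < Re (q z)" using Re_p0_pos [OF n \<sigma> neg z] by (simp add: q_def)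
    then show ?thesis by auto
  qed
  have "of_real a + \<i> * of_real b = ellhat n lam \<omega>"
    by (simp add: a_def b_def complex_eq_iff)
  then have q0: "q 0 = 1 / \<omega>"
    by (simp add: q_def p0_0 [OF \<sigma>] cayley_def) (simp add: ellhat_def)
  have "(cayley 1 has_field_derivative 2) (at (\<eta> * 0))"
    using cayley_deriv [of "\<eta> * 0" 1] by simp
  moreover have "((\<lambda>z. \<eta> * z) has_field_derivative \<eta>) (at 0)"
    by (auto intro!: derivative_eq_intros)
  ultimately have "((\<lambda>z. cayley 1 (\<eta> * z)) has_field_derivative 2 * \<eta>) (at 0)"
    by (rule DERIV_chain2)
  then have "(q has_field_derivative moment n \<sigma> lam + (of_real a * (2 * \<eta>) + 0)) (at 0)"
    unfolding q_def by (intro DERIV_add DERIV_cmult DERIV_const deriv_p0_0 [OF \<sigma>])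
  moreover have "moment n \<sigma> lam + (of_real a * (2 * \<eta>) + 0) = \<zeta> / (2 * \<omega>\<^sup>2)"
    using a\<eta> by (simp add: d_def mult_ac)
  ultimately have dq: "deriv q 0 = \<zeta> / (2 * \<omega>\<^sup>2)" by (metis DERIV_imp_deriv)
  have "Vpt (\<lambda>z. - z / q z) = (2 * deriv q 0 / (q 0)\<^sup>2, 1 / q 0)"
    by (rule Vpt_quotient [OF holq ne refl])
  also have "\<dots> = (\<zeta>, \<omega>)"
    unfolding q0 dq using False by (simp add: power_divide)
  finally have "(\<zeta>, \<omega>) = Vpt (\<lambda>z. - z / q z)" ..
  moreover have "(\<lambda>z. - z / q z) \<in> Gen0_FL n \<sigma> lam"
    unfolding q_def by (rule herglotz_imp_Gen0_FL [OF n inj \<sigma> neg a \<eta>])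
  ultimately show ?thesis by (rule image_eqI)
qed

theorem theorem6p5:
  fixes n :: nat and \<sigma> :: "nat \<Rightarrow> complex" and lam :: "nat \<Rightarrow> real"
  assumes "n \<ge> 1"
    and "inj_on \<sigma> {1..n}"
    and "\<forall>k\<in>{1..n}. cmod (\<sigma> k) = 1"
    and "\<forall>k\<in>{1..n}. lam k < 0"
  shows "Vpt ` Gen0_FL n \<sigma> lam = {(\<zeta>, \<omega>). \<omega> \<in> Omega n lam \<and> \<zeta> \<in> Zset n \<sigma> lam \<omega>}
    \<and> (\<forall>p \<in> frontier (Vpt ` Gen0_FL n \<sigma> lam).
         (\<exists>G\<in>Gen0_FL n \<sigma> lam. Vpt G = p)
       \<and> (\<forall>G1\<in>Gen0_FL n \<sigma> lam. \<forall>G2\<in>Gen0_FL n \<sigma> lam.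
            Vpt G1 = p \<longrightarrow> Vpt G2 = p \<longrightarrow> (\<forall>z\<in>unit_disk. G1 z = G2 z))
       \<and> (\<forall>G\<in>Gen0_FL n \<sigma> lam. Vpt G = p \<longrightarrow>
            (let \<omega> = snd p; ell = ellhat n lam \<omega> in
              (\<omega> \<in> interior (Omega n lam) \<and> (\<exists>s. cmod s = 1 \<and>
                 (\<forall>z\<in>unit_disk. G z = - z / ((s + z) / (s - z) * complex_of_real (Re ell)
                     + \<i> * complex_of_real (Im ell) + p0 n \<sigma> lam z))))
            \<or> (\<omega> \<in> frontier (Omega n lam) - {0} \<and>
                 (\<forall>z\<in>unit_disk. G z = - z / (\<i> * complex_of_real (Im ell) + p0 n \<sigma> lam z)))
            \<or> (\<forall>z\<in>unit_disk. G z = 0))))"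
proof -
  note F = assms
  have "(\<zeta>, \<omega>) \<in> Vpt ` Gen0_FL n \<sigma> lam \<longleftrightarrow> \<omega> \<in> Omega n lam \<and> \<zeta> \<in> Zset n \<sigma> lam \<omega>" for \<zeta> \<omega>
  proof
    assume "(\<zeta>, \<omega>) \<in> Vpt ` Gen0_FL n \<sigma> lam"
    then obtain G where G: "G \<in> Gen0_FL n \<sigma> lam" "Vpt G = (\<zeta>, \<omega>)" by auto
    show "\<omega> \<in> Omega n lam \<and> \<zeta> \<in> Zset n \<sigma> lam \<omega>"
    proof (cases rule: Gen0_FL_cases [OF F G])
      case 1
      then show ?thesis using Omega_iff(1) [OF F(1,4)] by (simp add: Zset_def)
    next
      case herglotz: (2 p)
      have "0 \<le> Re (ellhat n lam \<omega>)" using herglotz(3) [of 0] herglotz(5) by simp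
      moreover have "cmod (deriv p 0) \<le> 2 * Re (p 0)"
        by (rule caratheodory_coefficient(1) [OF herglotz(2,3)])
      ultimately show ?thesis
        using Omega_iff(1) [OF F(1,4)] Zset_iff [OF herglotz(1)] herglotz(5,6) by simp
    qed
  qed (use value_set_attained [OF F] in blast)
  then have V: "Vpt ` Gen0_FL n \<sigma> lam = {(\<zeta>, \<omega>). \<omega> \<in> Omega n lam \<and> \<zeta> \<in> Zset n \<sigma> lam \<omega>}"
    by auto
  then have V': "Vpt ` Gen0_FL n \<sigma> lam = {(\<zeta>, \<omega>).
      cmod (\<zeta> - 2 * \<omega>\<^sup>2 * moment n \<sigma> lam) \<le> 4 * Re \<omega> - 2 * (cmod \<omega>)\<^sup>2 * mass n lam}"
    by (simp only: value_set_polynomial [OF F(1,4)])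
  show ?thesis
  proof (rule conjI [OF V], rule ballI, intro conjI)
    fix p assume "p \<in> frontier (Vpt ` Gen0_FL n \<sigma> lam)"
    moreover obtain \<zeta> \<omega> where p: "p = (\<zeta>, \<omega>)" by fastforce
    ultimately have fr: "(\<zeta>, \<omega>) \<in> frontier (Vpt ` Gen0_FL n \<sigma> lam)" by simp
    show "\<exists>G\<in>Gen0_FL n \<sigma> lam. Vpt G = p"
      using frontier_value_set(1) [OF V' fr] p by auto
    note ext = Gen0_FL_extremal [OF F _ _ frontier_value_set(2) [OF V' fr]]
    show "\<forall>G1\<in>Gen0_FL n \<sigma> lam. \<forall>G2\<in>Gen0_FL n \<sigma> lam.
            Vpt G1 = p \<longrightarrow> Vpt G2 = p \<longrightarrow> (\<forall>z\<in>unit_disk. G1 z = G2 z)"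
    proof (intro ballI impI)
      fix G1 G2 z
      assume G: "G1 \<in> Gen0_FL n \<sigma> lam" "G2 \<in> Gen0_FL n \<sigma> lam" "Vpt G1 = p" "Vpt G2 = p"
        and z: "z \<in> unit_disk"
      have z': "z \<in> ball 0 1" using z by (simp add: unit_disk_def)
      \<comment> \<open>Unequal cases for \<open>G1\<close> and \<open>G2\<close> clash over
        \<open>\<omega> = 0\<close> or the sign of \<open>Re (ellhat n lam \<omega>)\<close>; in
        equal cases the formulas coincide, as \<open>s\<close> is the same expression in
        \<open>\<zeta>\<close> and \<open>\<omega>\<close>.\<close>
      show "G1 z = G2 z"
        by (rule ext [OF G(1) G(3) [unfolded p]]; rule ext [OF G(2) G(4) [unfolded p]]) (use z' in simp_all)
    qed
    show "\<forall>G\<in>Gen0_FL n \<sigma> lam. Vpt G = p \<longrightarrow>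
            (let \<omega> = snd p; ell = ellhat n lam \<omega> in
              (\<omega> \<in> interior (Omega n lam) \<and> (\<exists>s. cmod s = 1 \<and>
                 (\<forall>z\<in>unit_disk. G z = - z / ((s + z) / (s - z) * complex_of_real (Re ell)
                     + \<i> * complex_of_real (Im ell) + p0 n \<sigma> lam z))))
            \<or> (\<omega> \<in> frontier (Omega n lam) - {0} \<and>
                 (\<forall>z\<in>unit_disk. G z = - z / (\<i> * complex_of_real (Im ell) + p0 n \<sigma> lam z)))
            \<or> (\<forall>z\<in>unit_disk. G z = 0))"
      unfolding Let_def p snd_conv
    proof (intro ballI impI)
      fix G assume G: "G \<in> Gen0_FL n \<sigma> lam" "Vpt G = (\<zeta>, \<omega>)"
      show "(\<omega> \<in> interior (Omega n lam) \<and> (\<exists>s. cmod s = 1 \<and>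
                 (\<forall>z\<in>unit_disk. G z = - z / ((s + z) / (s - z) * complex_of_real (Re (ellhat n lam \<omega>))
                     + \<i> * complex_of_real (Im (ellhat n lam \<omega>)) + p0 n \<sigma> lam z))))
            \<or> (\<omega> \<in> frontier (Omega n lam) - {0} \<and>
                 (\<forall>z\<in>unit_disk. G z = - z / (\<i> * complex_of_real (Im (ellhat n lam \<omega>)) + p0 n \<sigma> lam z)))
            \<or> (\<forall>z\<in>unit_disk. G z = 0)" (is ?goal)
      proof (rule ext [OF G])
        assume "\<And>z. z \<in> ball 0 1 \<Longrightarrow> G z = 0"
        then show ?goal by (simp add: unit_disk_def)
      next
        assume "\<omega> \<noteq> 0" "Re (ellhat n lam \<omega>) = 0"
          "\<And>z. z \<in> ball 0 1 \<Longrightarrow> G z = - z / (\<i> * of_real (Im (ellhat n lam \<omega>)) + p0 n \<sigma> lam z)"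
        then show ?goal using Omega_iff(3) [OF F(1,4)] unfolding unit_disk_def by blast
      next
        fix s assume "\<omega> \<noteq> 0" "0 < Re (ellhat n lam \<omega>)" "cmod s = 1"
          "\<And>z. z \<in> ball 0 1 \<Longrightarrow> G z = - z / ((s + z) / (s - z) * of_real (Re (ellhat n lam \<omega>))
            + \<i> * of_real (Im (ellhat n lam \<omega>)) + p0 n \<sigma> lam z)"
        then show ?goal using Omega_iff(2) [OF F(1,4)] unfolding unit_disk_def by blast
      qed
    qed
  qed
qed

end
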